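(* Let $[\mathbf{G},\mathbf{o}]$ be a unimodular random rooted network with distribution $\mathcal{P}_0$ on $\mathcal{G}_*$, let $f$ be a vertex-shift, and let $n\ge1$. Then the distribution $\mathcal{P}_0^{f,n}$ of $[\mathbf{G},f^n(\mathbf{o})]$ is absolutely continuous with respect to the initial distribution $\mathcal{P}_0$, with Radon-Nikodym derivative $$\frac{d\mathcal{P}_0^{f,n}}{d\mathcal{P}_0}([G,o])=d_n(o),$$ where $d_n(o)=\#D_n(o)$ is the number of $n$-th descendants of $o$, with $D_n(o)=\{v\in V(G)\setminus\{o\}: f_G^n(v)=o\}$.
   Context: **Networks.** A network is a connected, locally finite graph $G$ whose vertices, and whose pairs (edge, endpoint), carry marks in $\mathbb{Z}$. $\mathcal{G}_*$ (resp. $\mathcal{G}_{**}$) is the Polish space of isomorphism classes $[G,o]$ of rooted (resp. $[G,u,v]$ of doubly rooted) networks with the local topology (convergence means that balls of each radius around the root(s) are eventually isomorphic as marked rooted graphs). **Unimodularity.** A random rooted network $[\mathbf{G},\mathbf{o}]$ is unimodular if $\mathbb{E}\big[\sum_{u\in V(\mathbf{G})}g([\mathbf{G},\mathbf{o},u])\big]=\mathbb{E}\big[\sum_{u\in V(\mathbf{G})}g([\mathbf{G},u,\mathbf{o}])\big]$ for all measurable $g:\mathcal{G}_{**}\to\mathbb{R}_{\ge0}$. **Vertex-shift.** A vertex-shift is a collection $f=(f_G)$ of maps $f_G:V(G)\to V(G)$ indexed by networks such that $f_H\circ\sigma=\sigma\circ f_G$ for each network isomorphism $\sigma:G\to H$,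 and $[G,u,v]\mapsto\mathbf{1}_{\{f_G(u)=v\}}$ is measurable on $\mathcal{G}_{**}$. $f_G^n$ is the $n$-th iterate of $f_G$, and $[\mathbf{G},f^n(\mathbf{o})]$ denotes $[\mathbf{G},f^n_{\mathbf{G}}(\mathbf{o})]$.
   Formalization: The derivative is proved to be d_n(o) + 1{f^n(o)=o}, not d_n(o): since D_n(o) excludes o, the stated formula fails when f^n(o)=o has positive probability (e.g. f the identity); the two agree whenever f^n(o)≠o almost surely. *)

theory Defs
  imports "HOL-Probability.Probability"
begin

section \<open>Networks and their isomorphisms\<close>

text \<open>
  Connected locally finite graphs are countable, so every network has an isomorphic copy whose
  vertices are natural numbers.  Graphs are undirected and simple; an edge is the two-element set of
  its endpoints.  The values of \<open>vmark\<close> and \<open>emark\<close> outside the vertices and outside the incident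
  pairs (edge, endpoint) carry no information: isomorphisms ignore them.
\<close>

record net =
  verts :: "nat set"
  edges :: "nat set set"
  vmark :: "nat \<Rightarrow> int"
  emark :: "nat set \<Rightarrow> nat \<Rightarrow> int"

definition adj :: "net \<Rightarrow> (nat \<times> nat) set" where
  "adj G = {(u, v). {u, v} \<in> edges G}"

definition network :: "net \<Rightarrow> bool" where
  "network G \<longleftrightarrow>
     verts G \<noteq> {} \<and>
     (\<forall>e\<in>edges G. e \<subseteq> verts G \<and> card e = 2) \<and>
     (\<forall>v\<in>verts G. finite {e \<in> edges G. v \<in> e}) \<and>
     (\<forall>u\<in>verts G. \<forall>v\<in>verts G. (u, v) \<in> (adj G)\<^sup>*)"

definition net_iso :: "(nat \<Rightarrow> nat) \<Rightarrow> net \<Rightarrow> net \<Rightarrow> bool" where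
  "net_iso \<sigma> G H \<longleftrightarrow>
     bij_betw \<sigma> (verts G) (verts H) \<and>
     edges H = (\<lambda>e. \<sigma> ` e) ` edges G \<and>
     (\<forall>v\<in>verts G. vmark H (\<sigma> v) = vmark G v) \<and>
     (\<forall>e\<in>edges G. \<forall>v\<in>e. emark H (\<sigma> ` e) (\<sigma> v) = emark G e v)"

lemma net_iso_refl: "net_iso id G G"
  by (simp add: net_iso_def)

lemma net_iso_sym:
  assumes "network G" "net_iso \<sigma> G H"
  shows "net_iso (inv_into (verts G) \<sigma>) H G"
proof -
  let ?\<tau> = "inv_into (verts G) \<sigma>"
  have bij: "bij_betw \<sigma> (verts G) (verts H)" and E: "edges H = (\<lambda>e. \<sigma> ` e) ` edges G"
    and vm: "\<And>v. v \<in> verts G \<Longrightarrow> vmark H (\<sigma> v) = vmark G v"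
    and em: "\<And>e v. e \<in> edges G \<Longrightarrow> v \<in> e \<Longrightarrow> emark H (\<sigma> ` e) (\<sigma> v) = emark G e v"
    using assms(2) by (auto simp: net_iso_def)
  have inj: "inj_on \<sigma> (verts G)" using bij by (simp add: bij_betw_def)
  have sub: "e \<subseteq> verts G" if "e \<in> edges G" for e
    using assms(1) that by (auto simp: network_def)
  have canc: "?\<tau> ` \<sigma> ` e = e" if "e \<in> edges G" for e
    using inv_into_image_cancel[OF inj sub[OF that]] .
  have "(\<lambda>e. ?\<tau> ` e) ` edges H = edges G"
    unfolding E image_image[of "\<lambda>e. ?\<tau> ` e"] using canc by simp
  moreover have "vmark G (?\<tau> v) = vmark H v" if v: "v \<in> verts H" for v
  proof -
    have "v \<in> \<sigma> ` verts G" using v bij by (simp add: bij_betw_def)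
    then show ?thesis using vm[of "?\<tau> v"] by (simp add: f_inv_into_f inv_into_into)
  qed
  moreover have "emark G (?\<tau> ` e) (?\<tau> v) = emark H e v" if e: "e \<in> edges H" "v \<in> e" for e v
  proof -
    have "e \<in> (\<lambda>e. \<sigma> ` e) ` edges G" using e(1) by (simp only: E)
    then obtain e' v' where *: "e' \<in> edges G" "e = \<sigma> ` e'" "v' \<in> e'" "v = \<sigma> v'"
      using e(2) by blast
    have "?\<tau> v = v'" using inv_into_f_f[OF inj, of v'] sub[OF *(1)] * by blast
    moreover have "?\<tau> ` e = e'" using canc[OF *(1)] * by simp
    ultimately show ?thesis using em[OF *(1,3)] * by simp
  qed
  ultimately show ?thesis
    using bij_betw_inv_into[OF bij] by (simp add: net_iso_def)
qed

lemma net_iso_inv_root: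
  "net_iso \<sigma> G H \<Longrightarrow> p \<in> verts G \<Longrightarrow> inv_into (verts G) \<sigma> (\<sigma> p) = p"
  by (simp add: net_iso_def bij_betw_def)

lemma net_iso_trans:
  assumes "net_iso \<sigma> G H" "net_iso \<tau> H K"
  shows "net_iso (\<tau> \<circ> \<sigma>) G K"
proof -
  have bG: "bij_betw \<sigma> (verts G) (verts H)" and EH: "edges H = (\<lambda>e. \<sigma> ` e) ` edges G"
    and vG: "\<And>v. v \<in> verts G \<Longrightarrow> vmark H (\<sigma> v) = vmark G v"
    and eG: "\<And>e v. e \<in> edges G \<Longrightarrow> v \<in> e \<Longrightarrow> emark H (\<sigma> ` e) (\<sigma> v) = emark G e v"
    using assms(1) by (auto simp: net_iso_def)
  have bH: "bij_betw \<tau> (verts H) (verts K)" and EK: "edges K = (\<lambda>e. \<tau> ` e) ` edges H"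
    and vH: "\<And>v. v \<in> verts H \<Longrightarrow> vmark K (\<tau> v) = vmark H v"
    and eH: "\<And>e v. e \<in> edges H \<Longrightarrow> v \<in> e \<Longrightarrow> emark K (\<tau> ` e) (\<tau> v) = emark H e v"
    using assms(2) by (auto simp: net_iso_def)
  have "edges K = (\<lambda>e. (\<tau> \<circ> \<sigma>) ` e) ` edges G"
    unfolding EK EH by (simp add: image_image image_comp)
  moreover have "vmark K ((\<tau> \<circ> \<sigma>) v) = vmark G v" if "v \<in> verts G" for v
    using vG[OF that] vH[of "\<sigma> v"] bij_betwE[OF bG] that by simp
  moreover have "emark K ((\<tau> \<circ> \<sigma>) ` e) ((\<tau> \<circ> \<sigma>) v) = emark G e v"
    if "e \<in> edges G" "v \<in> e" for e v
    using eH[of "\<sigma> ` e" "\<sigma> v"] eG[OF that] that by (simp add: EH image_image)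
  ultimately show ?thesis
    using bij_betw_trans[OF bG bH] by (simp only: net_iso_def) simp
qed


section \<open>The spaces of rooted and doubly rooted networks\<close>

definition rooted_iso :: "net \<times> nat \<Rightarrow> net \<times> nat \<Rightarrow> bool" where
  "rooted_iso = (\<lambda>(G, p) (H, q).
     network G \<and> network H \<and> p \<in> verts G \<and> q \<in> verts H \<and> (\<exists>\<sigma>. net_iso \<sigma> G H \<and> \<sigma> p = q))"

definition birooted_iso :: "net \<times> nat \<times> nat \<Rightarrow> net \<times> nat \<times> nat \<Rightarrow> bool" where
  "birooted_iso = (\<lambda>(G, p, p') (H, q, q').
     network G \<and> network H \<and> p \<in> verts G \<and> p' \<in> verts G \<and> q \<in> verts H \<and> q' \<in> verts H \<and>
     (\<exists>\<sigma>. net_iso \<sigma> G H \<and> \<sigma> p = q \<and> \<sigma> p' = q'))"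

definition single_net :: net where
  "single_net = \<lparr>verts = {0}, edges = {}, vmark = (\<lambda>_. 0), emark = (\<lambda>_ _. 0)\<rparr>"

lemma network_single_net: "network single_net"
  by (simp add: network_def single_net_def)

lemma part_equivp_rooted_iso: "part_equivp rooted_iso"
proof (rule part_equivpI)
  show "\<exists>x. rooted_iso x x"
    using network_single_net net_iso_refl[of single_net]
    by (intro exI[of _ "(single_net, 0)"])
      (auto simp: rooted_iso_def single_net_def intro!: exI[of _ id])
  show "symp rooted_iso"
  proof (rule sympI, clarsimp simp: rooted_iso_def)
    fix G H p \<sigma>
    assume "network G" "p \<in> verts G" "net_iso \<sigma> G H"
    then show "\<exists>\<tau>. net_iso \<tau> H G \<and> \<tau> (\<sigma> p) = p"
      using net_iso_sym[of G \<sigma> H] net_iso_inv_root[of \<sigma> G H p] by blast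
  qed
  show "transp rooted_iso"
  proof (rule transpI, clarsimp simp: rooted_iso_def)
    fix G H K p \<sigma> \<tau>
    assume "network G" "net_iso \<sigma> G H" "net_iso \<tau> H K"
    then show "\<exists>\<rho>. net_iso \<rho> G K \<and> \<rho> p = \<tau> (\<sigma> p)"
      using net_iso_trans[of \<sigma> G H \<tau> K] by (metis comp_apply)
  qed
qed

lemma part_equivp_birooted_iso: "part_equivp birooted_iso"
proof (rule part_equivpI)
  show "\<exists>x. birooted_iso x x"
    using network_single_net net_iso_refl[of single_net]
    by (intro exI[of _ "(single_net, 0, 0)"])
      (auto simp: birooted_iso_def single_net_def intro!: exI[of _ id])
  show "symp birooted_iso"
  proof (rule sympI, clarsimp simp: birooted_iso_def)
    fix G H p p' \<sigma>
    assume "network G" "p \<in> verts G" "p' \<in> verts G" "net_iso \<sigma> G H"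
    then show "\<exists>\<tau>. net_iso \<tau> H G \<and> \<tau> (\<sigma> p) = p \<and> \<tau> (\<sigma> p') = p'"
      using net_iso_sym[of G \<sigma> H] net_iso_inv_root[of \<sigma> G H] by blast
  qed
  show "transp birooted_iso"
  proof (rule transpI, clarsimp simp: birooted_iso_def)
    fix G H K p p' \<sigma> \<tau>
    assume "network G" "net_iso \<sigma> G H" "net_iso \<tau> H K"
    then show "\<exists>\<rho>. net_iso \<rho> G K \<and> \<rho> p = \<tau> (\<sigma> p) \<and> \<rho> p' = \<tau> (\<sigma> p')"
      using net_iso_trans[of \<sigma> G H \<tau> K] by (metis comp_apply)
  qed
qed

quotient_type rnet = "net \<times> nat" / partial: rooted_iso
  by (rule part_equivp_rooted_iso)

quotient_type dnet = "net \<times> nat \<times> nat" / partial: birooted_iso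
  by (rule part_equivp_birooted_iso)


lemma rep_rnet_abs:
  assumes "network G" "p \<in> verts G"
  shows "rooted_iso (rep_rnet (abs_rnet (G, p))) (G, p)"
proof (rule Quotient_rep_abs[OF Quotient_rnet])
  show "rooted_iso (G, p) (G, p)"
    using assms by (auto simp: rooted_iso_def intro: exI[of _ id] net_iso_refl)
qed

lemma rep_rnet_absE:
  assumes "network G" "p \<in> verts G"
  obtains H q \<sigma> where "rep_rnet (abs_rnet (G, p)) = (H, q)" "network H" "q \<in> verts H"
    "net_iso \<sigma> H G" "\<sigma> q = p"
  using rep_rnet_abs[OF assms] by (cases "rep_rnet (abs_rnet (G, p))") (auto simp: rooted_iso_def)

lemma abs_rnet_eqI:
  assumes "network G" "network H" "p \<in> verts G" "net_iso \<sigma> G H" "\<sigma> p = q"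
  shows "abs_rnet (G, p) = abs_rnet (H, q)"
proof -
  have "q \<in> verts H" using assms by (auto simp: net_iso_def bij_betw_def)
  then have "rooted_iso (G, p) (H, q)" using assms by (auto simp: rooted_iso_def)
  then show ?thesis by (rule Quotient_rel_abs[OF Quotient_rnet])
qed

lemma abs_dnet_eqI:
  assumes "network G" "network H" "p \<in> verts G" "p' \<in> verts G" "net_iso \<sigma> G H"
    "\<sigma> p = q" "\<sigma> p' = q'"
  shows "abs_dnet (G, p, p') = abs_dnet (H, q, q')"
proof -
  have "q \<in> verts H" "q' \<in> verts H" using assms by (auto simp: net_iso_def bij_betw_def)
  then have "birooted_iso (G, p, p') (H, q, q')" using assms by (auto simp: birooted_iso_def)
  then show ?thesis by (rule Quotient_rel_abs[OF Quotient_dnet])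
qed


section \<open>The local topology\<close>

text \<open>
  The basic sets are the classes whose ball of a given radius looks like a prescribed one.  For a
  fixed radius they partition the space, so a sequence converges to \<open>[G, o]\<close> iff its balls of each
  radius are eventually isomorphic to those of \<open>[G, o]\<close>.
\<close>

definition nball :: "net \<Rightarrow> nat \<Rightarrow> nat set \<Rightarrow> nat set" where
  "nball G r S = {v \<in> verts G. \<exists>s\<in>S. \<exists>k\<le>r. (s, v) \<in> adj G ^^ k}"

definition induced :: "net \<Rightarrow> nat set \<Rightarrow> net" where
  "induced G B = G\<lparr>verts := verts G \<inter> B, edges := {e \<in> edges G. e \<subseteq> B}\<rparr>"

definition rcyl :: "nat \<Rightarrow> net \<Rightarrow> nat \<Rightarrow> rnet set" where
  "rcyl r G p = {abs_rnet (H, q) | H q. network H \<and> q \<in> verts H \<and>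
     (\<exists>\<sigma>. net_iso \<sigma> (induced G (nball G r {p})) (induced H (nball H r {q})) \<and> \<sigma> p = q)}"

definition dcyl :: "nat \<Rightarrow> net \<Rightarrow> nat \<Rightarrow> nat \<Rightarrow> dnet set" where
  "dcyl r G p p' = {abs_dnet (H, q, q') | H q q'. network H \<and> q \<in> verts H \<and> q' \<in> verts H \<and>
     (\<exists>\<sigma>. net_iso \<sigma> (induced G (nball G r {p, p'})) (induced H (nball H r {q, q'})) \<and>
        \<sigma> p = q \<and> \<sigma> p' = q')}"

instantiation rnet :: topological_space
begin

definition open_rnet :: "rnet set \<Rightarrow> bool" where
  "open_rnet = generate_topology {rcyl r G p | r G p. network G \<and> p \<in> verts G}"

instance
  by intro_classes
    (auto simp: open_rnet_def intro: generate_topology.intros)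

end

instantiation dnet :: topological_space
begin

definition open_dnet :: "dnet set \<Rightarrow> bool" where
  "open_dnet =
     generate_topology {dcyl r G p p' | r G p p'. network G \<and> p \<in> verts G \<and> p' \<in> verts G}"

instance
  by intro_classes
    (auto simp: open_dnet_def intro: generate_topology.intros)

end


section \<open>Unimodularity\<close>

definition mass_out :: "(dnet \<Rightarrow> real) \<Rightarrow> rnet \<Rightarrow> ennreal" where
  "mass_out g x = (case rep_rnet x of (G, p) \<Rightarrow>
     \<integral>\<^sup>+u. ennreal (g (abs_dnet (G, p, u))) \<partial>count_space (verts G))"

definition mass_in :: "(dnet \<Rightarrow> real) \<Rightarrow> rnet \<Rightarrow> ennreal" where
  "mass_in g x = (case rep_rnet x of (G, p) \<Rightarrow>
     \<integral>\<^sup>+u. ennreal (g (abs_dnet (G, u, p))) \<partial>count_space (verts G))"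

definition unimodular :: "'a measure \<Rightarrow> ('a \<Rightarrow> rnet) \<Rightarrow> bool" where
  "unimodular M X \<longleftrightarrow>
     (\<forall>g :: dnet \<Rightarrow> real. g \<in> borel_measurable borel \<longrightarrow> (\<forall>x. 0 \<le> g x) \<longrightarrow>
        (\<integral>\<^sup>+\<omega>. mass_out g (X \<omega>) \<partial>M) = (\<integral>\<^sup>+\<omega>. mass_in g (X \<omega>) \<partial>M))"

lemma mass_out_abs:
  assumes "network G" "p \<in> verts G"
  shows "mass_out g (abs_rnet (G, p)) =
    (\<integral>\<^sup>+u. ennreal (g (abs_dnet (G, p, u))) \<partial>count_space (verts G))"
proof -
  obtain H q \<sigma> where H: "rep_rnet (abs_rnet (G, p)) = (H, q)" "network H" "q \<in> verts H"
    "net_iso \<sigma> H G" "\<sigma> q = p"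
    using rep_rnet_absE[OF assms] .
  have "(\<integral>\<^sup>+u. ennreal (g (abs_dnet (H, q, u))) \<partial>count_space (verts H)) =
      (\<integral>\<^sup>+u. ennreal (g (abs_dnet (G, p, \<sigma> u))) \<partial>count_space (verts H))"
    using H(5) abs_dnet_eqI[OF H(2) assms(1) _ _ H(4)] H(3) by (intro nn_integral_cong) simp
  also have "\<dots> = (\<integral>\<^sup>+u. ennreal (g (abs_dnet (G, p, u))) \<partial>count_space (verts G))"
    using H(4) by (intro nn_integral_bij_count_space) (simp add: net_iso_def)
  finally show ?thesis by (simp add: mass_out_def H(1))
qed

lemma mass_in_abs:
  assumes "network G" "p \<in> verts G"
  shows "mass_in g (abs_rnet (G, p)) =
    (\<integral>\<^sup>+u. ennreal (g (abs_dnet (G, u, p))) \<partial>count_space (verts G))"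
proof -
  obtain H q \<sigma> where H: "rep_rnet (abs_rnet (G, p)) = (H, q)" "network H" "q \<in> verts H"
    "net_iso \<sigma> H G" "\<sigma> q = p"
    using rep_rnet_absE[OF assms] .
  have "(\<integral>\<^sup>+u. ennreal (g (abs_dnet (H, u, q))) \<partial>count_space (verts H)) =
      (\<integral>\<^sup>+u. ennreal (g (abs_dnet (G, \<sigma> u, p))) \<partial>count_space (verts H))"
    using H(5) abs_dnet_eqI[OF H(2) assms(1) _ _ H(4)] H(3) by (intro nn_integral_cong) simp
  also have "\<dots> = (\<integral>\<^sup>+u. ennreal (g (abs_dnet (G, u, p))) \<partial>count_space (verts G))"
    using H(4) by (intro nn_integral_bij_count_space) (simp add: net_iso_def)
  finally show ?thesis by (simp add: mass_in_def H(1))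
qed


section \<open>Vertex-shifts\<close>

definition shift_pairs :: "(net \<Rightarrow> nat \<Rightarrow> nat) \<Rightarrow> dnet set" where
  "shift_pairs f =
     {abs_dnet (G, u, v) | G u v. network G \<and> u \<in> verts G \<and> v \<in> verts G \<and> f G u = v}"

definition vertex_shift :: "(net \<Rightarrow> nat \<Rightarrow> nat) \<Rightarrow> bool" where
  "vertex_shift f \<longleftrightarrow>
     (\<forall>G. network G \<longrightarrow> f G \<in> verts G \<rightarrow> verts G) \<and>
     (\<forall>G H \<sigma>. network G \<longrightarrow> network H \<longrightarrow> net_iso \<sigma> G H \<longrightarrow>
        (\<forall>u\<in>verts G. f H (\<sigma> u) = \<sigma> (f G u))) \<and>
     (indicator (shift_pairs f) :: dnet \<Rightarrow> real) \<in> borel_measurable borel"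

definition move_root :: "(net \<Rightarrow> nat \<Rightarrow> nat) \<Rightarrow> nat \<Rightarrow> rnet \<Rightarrow> rnet" where
  "move_root f n x = (case rep_rnet x of (G, p) \<Rightarrow> abs_rnet (G, (f G ^^ n) p))"

definition descendants :: "(net \<Rightarrow> nat \<Rightarrow> nat) \<Rightarrow> nat \<Rightarrow> net \<Rightarrow> nat \<Rightarrow> nat set" where
  "descendants f n G p = {v \<in> verts G - {p}. (f G ^^ n) v = p}"

text \<open>Counting measure, not \<^const>\<open>card\<close>: a vertex may have infinitely many descendants.\<close>

definition desc_count :: "(net \<Rightarrow> nat \<Rightarrow> nat) \<Rightarrow> nat \<Rightarrow> rnet \<Rightarrow> ennreal" where
  "desc_count f n x = (case rep_rnet x of (G, p) \<Rightarrow>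
     emeasure (count_space UNIV) (descendants f n G p))"

text \<open>
  \<open>descendants\<close> leaves out the vertex itself, so it misses the mass that returns to the root when
  \<open>f\<^sup>n(o) = o\<close>.  For the identity shift \<open>desc_count\<close> is \<open>0\<close> everywhere although the root keeps its
  distribution, whose density with respect to itself is \<open>1\<close>.  The density is therefore
  \<open>desc_count\<close> plus the indicator of \<open>root_returns\<close>, that is, the number of all \<open>v\<close> with
  \<open>f\<^sup>n(v) = o\<close>; the two counts agree at every root that is not \<open>n\<close>-periodic.
\<close>

definition root_returns :: "(net \<Rightarrow> nat \<Rightarrow> nat) \<Rightarrow> nat \<Rightarrow> rnet \<Rightarrow> bool" where
  "root_returns f n x = (case rep_rnet x of (G, p) \<Rightarrow> (f G ^^ n) p = p)"

lemma funpow_in_verts: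
  assumes "vertex_shift f" "network G" "p \<in> verts G"
  shows "(f G ^^ n) p \<in> verts G"
  using assms by (induction n) (auto simp: vertex_shift_def)

lemma funpow_iso:
  assumes "vertex_shift f" "network G" "network H" "net_iso \<sigma> G H" "p \<in> verts G"
  shows "(f H ^^ n) (\<sigma> p) = \<sigma> ((f G ^^ n) p)"
proof (induction n)
  case (Suc n)
  have "f H (\<sigma> u) = \<sigma> (f G u)" if "u \<in> verts G" for u
    using assms that unfolding vertex_shift_def by blast
  then show ?case
    using Suc funpow_in_verts[OF assms(1,2,5)] by simp
qed simp

lemma move_root_abs:
  assumes "vertex_shift f" "network G" "p \<in> verts G"
  shows "move_root f n (abs_rnet (G, p)) = abs_rnet (G, (f G ^^ n) p)"
proof -
  obtain H q \<sigma> where H: "rep_rnet (abs_rnet (G, p)) = (H, q)" "network H" "q \<in> verts H"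
    "net_iso \<sigma> H G" "\<sigma> q = p"
    using rep_rnet_absE[OF assms(2,3)] .
  have "abs_rnet (H, (f H ^^ n) q) = abs_rnet (G, (f G ^^ n) p)"
    using H assms funpow_iso[OF assms(1) H(2) assms(2) H(4,3), of n]
      funpow_in_verts[OF assms(1) H(2,3)]
    by (intro abs_rnet_eqI[where \<sigma> = \<sigma>]) auto
  then show ?thesis by (simp add: move_root_def H(1))
qed

lemma root_returns_abs:
  assumes "vertex_shift f" "network G" "p \<in> verts G"
  shows "root_returns f n (abs_rnet (G, p)) \<longleftrightarrow> (f G ^^ n) p = p"
proof -
  obtain H q \<sigma> where H: "rep_rnet (abs_rnet (G, p)) = (H, q)" "network H" "q \<in> verts H"
    "net_iso \<sigma> H G" "\<sigma> q = p"
    using rep_rnet_absE[OF assms(2,3)] .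
  have "inj_on \<sigma> (verts H)" using H(4) by (simp add: net_iso_def bij_betw_def)
  then have "(f H ^^ n) q = q \<longleftrightarrow> \<sigma> ((f H ^^ n) q) = \<sigma> q"
    using H(3) funpow_in_verts[OF assms(1) H(2,3)] by (simp add: inj_on_eq_iff)
  then show ?thesis
    using funpow_iso[OF assms(1) H(2) assms(2) H(4,3)] H by (simp add: root_returns_def)
qed

lemma desc_count_abs:
  assumes "vertex_shift f" "network G" "p \<in> verts G"
  shows "desc_count f n (abs_rnet (G, p)) = emeasure (count_space UNIV) (descendants f n G p)"
proof -
  obtain H q \<sigma> where H: "rep_rnet (abs_rnet (G, p)) = (H, q)" "network H" "q \<in> verts H"
    "net_iso \<sigma> H G" "\<sigma> q = p"
    using rep_rnet_absE[OF assms(2,3)] .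
  have inj: "inj_on \<sigma> (verts H)" and im: "\<sigma> ` verts H = verts G"
    using H(4) by (simp_all add: net_iso_def bij_betw_def)
  have eq: "\<sigma> v \<in> descendants f n G p \<longleftrightarrow> v \<in> descendants f n H q" if "v \<in> verts H" for v
    using that H(3,5) im inj_on_eq_iff[OF inj] funpow_iso[OF assms(1) H(2) assms(2) H(4) that]
      funpow_in_verts[OF assms(1) H(2) that]
    by (auto simp: descendants_def)
  have "bij_betw \<sigma> (descendants f n H q) (descendants f n G p)"
  proof (rule bij_betw_imageI)
    show "inj_on \<sigma> (descendants f n H q)"
      using inj by (rule inj_on_subset) (auto simp: descendants_def)
    show "\<sigma> ` descendants f n H q = descendants f n G p"
    proof (intro equalityI subsetI)
      fix w assume w: "w \<in> descendants f n G p"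
      then obtain v where "v \<in> verts H" "w = \<sigma> v" using im by (auto simp: descendants_def)
      then show "w \<in> \<sigma> ` descendants f n H q" using w eq by blast
    next
      fix w assume "w \<in> \<sigma> ` descendants f n H q"
      then obtain v where v: "v \<in> descendants f n H q" "w = \<sigma> v" by blast
      then have "v \<in> verts H" by (simp add: descendants_def)
      then show "w \<in> descendants f n G p" using v eq by blast
    qed
  qed
  then have "finite (descendants f n H q) \<longleftrightarrow> finite (descendants f n G p)"
    and "card (descendants f n H q) = card (descendants f n G p)"
    by (auto simp: bij_betw_finite bij_betw_same_card)
  then show ?thesis by (simp add: desc_count_def H(1) emeasure_count_space)
qed

end

theory Submission
  imports Defs
begin

text \<open>
  For \<open>\<psi> \<ge> 0\<close> put \<open>T \<psi> [G, o] = (\<Sum>u | f u = o. \<psi> [G, u])\<close>.  Mass transport with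
  \<open>g [G, u, v] = of_bool (f u = v) * \<psi> [G, u] * \<phi> [G, v]\<close> gives
  \<open>E (\<psi> [G, o] * \<phi> [G, f o]) = E (T \<psi> [G, o] * \<phi> [G, o])\<close>.  Iterating,
  \<open>E \<phi> [G, f\<^sup>n o] = E (T\<^sup>n 1 [G, o] * \<phi> [G, o])\<close>, and \<open>T\<^sup>n 1 [G, o]\<close> counts the \<open>v\<close> with
  \<open>f\<^sup>n v = o\<close>.  Iterating the one-step identity avoids having to show that \<open>f\<^sup>n\<close> is itself a measurable
  vertex-shift.  Measurability in \<open>[G, o]\<close> of sums \<open>\<Sum>u. g [G, o, u]\<close> comes from the local topology:
  for the indicator of a set determined by the \<open>r\<close>-ball around the roots, the sum over
  the \<open>R\<close>-ball of \<open>o\<close> depends only on the \<open>(R + r)\<close>-ball, and such sets generate the Borel sets.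
\<close>

section \<open>Balls and cylinders\<close>

lemma nball_0: "S \<subseteq> verts G \<Longrightarrow> nball G 0 S = S"
  by (auto simp: nball_def)

text \<open>Splitting off the last edge of a walk replaces walks of length at most \<open>r\<close>
  by a layer-by-layer recursion, so that facts about balls can be proved by induction on the
  radius.\<close>

lemma nball_Suc:
  assumes "network G"
  shows "nball G (Suc r) S = nball G r S \<union> {v. \<exists>u\<in>nball G r S. {u, v} \<in> edges G}"
proof (intro equalityI subsetI)
  fix v assume "v \<in> nball G (Suc r) S"
  then obtain s k where k: "v \<in> verts G" "s \<in> S" "k \<le> Suc r" "(s, v) \<in> adj G ^^ k"
    by (auto simp: nball_def)
  show "v \<in> nball G r S \<union> {v. \<exists>u\<in>nball G r S. {u, v} \<in> edges G}"
  proof (cases "k \<le> r")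
    case True
    then show ?thesis using k by (auto simp: nball_def)
  next
    case False
    then have "k = Suc r" using k(3) by simp
    then obtain u where u: "(s, u) \<in> adj G ^^ r" "(u, v) \<in> adj G" using k(4) by auto
    then have e: "{u, v} \<in> edges G" by (simp add: adj_def)
    then have "u \<in> verts G" using assms unfolding network_def by blast
    then have "u \<in> nball G r S" using u(1) k(2) unfolding nball_def by blast
    then show ?thesis using e by blast
  qed
next
  fix v assume "v \<in> nball G r S \<union> {v. \<exists>u\<in>nball G r S. {u, v} \<in> edges G}"
  then show "v \<in> nball G (Suc r) S"
  proof (elim UnE CollectE bexE)
    assume "v \<in> nball G r S"
    then show ?thesis by (auto simp: nball_def intro: le_SucI)
  next
    fix u assume u: "u \<in> nball G r S" "{u, v} \<in> edges G"
    then have "v \<in> verts G" using assms unfolding network_def by blast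
    moreover obtain s k where "s \<in> S" "k \<le> r" "(s, u) \<in> adj G ^^ k"
      using u(1) by (auto simp: nball_def)
    moreover from this have "(s, v) \<in> adj G ^^ Suc k" using u(2) by (auto simp: adj_def)
    ultimately show ?thesis unfolding nball_def by blast
  qed
qed

lemma nball_subset_verts: "nball G r S \<subseteq> verts G"
  by (auto simp: nball_def)

lemma nball_mono: "r \<le> s \<Longrightarrow> S \<subseteq> T \<Longrightarrow> nball G r S \<subseteq> nball G s T"
  unfolding nball_def by (blast intro: order_trans)

text \<open>The triangle inequality: walks of lengths at most \<open>t\<close> and \<open>r\<close>
  concatenate.\<close>

lemma nball_nball: "nball G r (nball G t S) \<subseteq> nball G (t + r) S"
proof
  fix v assume "v \<in> nball G r (nball G t S)"
  then obtain u k s l where *: "v \<in> verts G" "k \<le> r" "(u, v) \<in> adj G ^^ k"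
    "s \<in> S" "l \<le> t" "(s, u) \<in> adj G ^^ l"
    unfolding nball_def by blast
  then have "(s, v) \<in> adj G ^^ (l + k)" by (auto simp: relpow_add)
  then show "v \<in> nball G (t + r) S" using * unfolding nball_def
    by (blast intro: add_mono)
qed

text \<open>Local finiteness enters here: each vertex of a layer lies on finitely many edges, each
  with two endpoints. Finite balls later make the subtraction of ball sums legitimate.\<close>

lemma finite_nball:
  assumes "network G" "finite S" "S \<subseteq> verts G"
  shows "finite (nball G r S)"
proof (induction r)
  case 0
  then show ?case using assms by (simp add: nball_0)
next
  case (Suc r)
  have "finite {v. {u, v} \<in> edges G}" if "u \<in> nball G r S" for u
  proof -
    have "u \<in> verts G" using that nball_subset_verts by blast
    then have fin: "finite {e \<in> edges G. u \<in> e}"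
      using assms(1) by (auto simp: network_def)
    \<comment> \<open>\<open>card\<close> is 0 on infinite sets, so a set of cardinality 2 is
      finite.\<close>
    have "finite e" if "e \<in> edges G" for e
      using assms(1) that by (auto simp: network_def intro: card_ge_0_finite)
    then have "finite (\<Union> {e \<in> edges G. u \<in> e})" using fin by blast
    then show ?thesis by (rule rev_finite_subset) blast
  qed
  moreover have "{v. \<exists>u\<in>nball G r S. {u, v} \<in> edges G} = (\<Union>u\<in>nball G r S. {v. {u, v} \<in> edges G})"
    by blast
  ultimately show ?case using Suc by (simp add: nball_Suc[OF assms(1)])
qed

text \<open>Connectedness enters here: every vertex is joined to the root by a walk of some finite
  length.\<close>

lemma verts_exhausted:
  assumes "network G" "p \<in> verts G"
  shows "(\<Union>r. nball G r {p}) = verts G"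
proof (intro equalityI subsetI)
  fix v assume v: "v \<in> verts G"
  then have "(p, v) \<in> (adj G)\<^sup>*" using assms by (auto simp: network_def)
  then obtain k where "(p, v) \<in> adj G ^^ k" by (auto simp: rtrancl_is_UN_relpow)
  then have "v \<in> nball G k {p}" using v by (auto simp: nball_def)
  then show "v \<in> (\<Union>r. nball G r {p})" by blast
qed (use nball_subset_verts in blast)

text \<open>An isomorphism of induced subgraphs sees only the edges inside \<open>A\<close> and
  \<open>B\<close>. As long as the balls on both sides stay inside these sets, every edge to the
  next layer has an image and a preimage, and the balls match layer by layer.\<close>

lemma nball_image:
  assumes G: "network G" and H: "network H"
    and iso: "net_iso \<sigma> (induced G A) (induced H B)"
    and S: "S \<subseteq> verts G" "S \<subseteq> A"
    and sub: "nball G r S \<subseteq> A" "nball H r (\<sigma> ` S) \<subseteq> B"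
  shows "\<sigma> ` nball G r S = nball H r (\<sigma> ` S)"
  \<comment> \<open>The inclusions enter the induction as premises: at radius \<open>Suc r\<close>
    they place the newly reached endpoints in \<open>A\<close> and \<open>B\<close>.\<close>
  using sub
proof (induction r)
  have bij: "bij_betw \<sigma> (verts G \<inter> A) (verts H \<inter> B)"
    and E: "{e \<in> edges H. e \<subseteq> B} = (\<lambda>e. \<sigma> ` e) ` {e \<in> edges G. e \<subseteq> A}"
    using iso by (auto simp: net_iso_def induced_def)
  {
    case 0
    have "\<sigma> ` S \<subseteq> verts H" using bij S by (auto simp: bij_betw_def)
    then show ?case using S by (simp add: nball_0)
  next
    case (Suc r)
    have sub: "nball G r S \<subseteq> A" "nball H r (\<sigma> ` S) \<subseteq> B"
      using Suc.prems by (auto simp: nball_Suc[OF G] nball_Suc[OF H])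
    note IH = Suc.IH[OF sub]
    have inj: "inj_on \<sigma> (verts G \<inter> A)" using bij by (simp add: bij_betw_def)
    have "\<sigma> ` {v. \<exists>u\<in>nball G r S. {u, v} \<in> edges G}
        = {v. \<exists>u\<in>nball H r (\<sigma> ` S). {u, v} \<in> edges H}"
    proof (intro equalityI subsetI; clarify)
      fix u v assume u: "u \<in> nball G r S" "{u, v} \<in> edges G"
      then have "v \<in> A" using Suc.prems(1) by (auto simp: nball_Suc[OF G])
      moreover have "u \<in> A" using u sub by blast
      ultimately have "\<sigma> ` {u, v} \<in> edges H" using u(2) E by blast
      then show "\<exists>u\<in>nball H r (\<sigma> ` S). {u, \<sigma> v} \<in> edges H"
        using u(1) IH by (intro bexI[of _ "\<sigma> u"]) auto
    next
      fix x y assume x: "x \<in> nball H r (\<sigma> ` S)" "{x, y} \<in> edges H"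
      then have "y \<in> B" using Suc.prems(2) by (auto simp: nball_Suc[OF H])
      moreover have "x \<in> B" using x sub by blast
      ultimately have "{x, y} \<in> {e \<in> edges H. e \<subseteq> B}" using x(2) by blast
      then obtain e where e: "e \<in> edges G" "e \<subseteq> A" "{x, y} = \<sigma> ` e" unfolding E by blast
      \<comment> \<open>The edge \<open>e\<close> is known only through its image. Injectivity
        identifies its endpoint over \<open>x\<close> with \<open>u\<close>; the other endpoint then
        lies over \<open>y\<close>, since \<open>x\<close> and \<open>y\<close> differ.\<close>
      obtain u where u: "u \<in> nball G r S" "x = \<sigma> u" using x(1) IH by blast
      have "e \<subseteq> verts G" using G e(1) by (auto simp: network_def)
      obtain c where c: "c \<in> e" "x = \<sigma> c" using e(3) by blast
      have "u \<in> verts G \<inter> A" using u(1) sub nball_subset_verts by blast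
      moreover have "c \<in> verts G \<inter> A" using c(1) e(2) \<open>e \<subseteq> verts G\<close> by blast
      ultimately have "c = u" using inj u(2) c(2) by (metis inj_onD)
      have "card e = 2" using G e(1) by (simp add: network_def)
      then obtain a b where "e = {a, b}" by (auto simp: card_2_iff)
      then obtain v where v: "e = {u, v}" using c(1) \<open>c = u\<close> by blast
      have "card {x, y} = 2" using H x(2) by (auto simp: network_def)
      then have "x \<noteq> y" by auto
      then have "y = \<sigma> v" using e(3) u(2) v by auto
      then show "y \<in> \<sigma> ` {v. \<exists>u\<in>nball G r S. {u, v} \<in> edges G}"
        using u(1) v e(1) by blast
    qed
    then show ?case using IH by (simp add: nball_Suc[OF G] nball_Suc[OF H] image_Un)
  }
qed

text \<open>Injectivity on the larger set lets edges restrict: an edge inside \<open>A\<close> whose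
  image lies in the image of \<open>A'\<close> already lies in \<open>A'\<close>.\<close>

lemma net_iso_subset:
  assumes G: "network G" and iso: "net_iso \<sigma> (induced G A) (induced H B)"
    and A': "A' \<subseteq> A" "A' \<subseteq> verts G" and B': "\<sigma> ` A' = B'"
  shows "net_iso \<sigma> (induced G A') (induced H B')"
proof -
  have bij: "bij_betw \<sigma> (verts G \<inter> A) (verts H \<inter> B)"
    and E: "{e \<in> edges H. e \<subseteq> B} = (\<lambda>e. \<sigma> ` e) ` {e \<in> edges G. e \<subseteq> A}"
    and vm: "\<And>v. v \<in> verts G \<inter> A \<Longrightarrow> vmark H (\<sigma> v) = vmark G v"
    and em: "\<And>e v. e \<in> edges G \<Longrightarrow> e \<subseteq> A \<Longrightarrow> v \<in> e \<Longrightarrow> emark H (\<sigma> ` e) (\<sigma> v) = emark G e v"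
    using iso by (auto simp: net_iso_def induced_def)
  have inj: "inj_on \<sigma> (verts G \<inter> A)" and im: "\<sigma> ` (verts G \<inter> A) = verts H \<inter> B"
    using bij by (simp_all add: bij_betw_def)
  have BH: "B' \<subseteq> verts H \<inter> B" using im A' B' by blast
  have "bij_betw \<sigma> A' B'"
    using inj_on_subset[OF inj, of A'] A' B' by (auto simp: bij_betw_def)
  moreover have "{e \<in> edges H. e \<subseteq> B'} = (\<lambda>e. \<sigma> ` e) ` {e \<in> edges G. e \<subseteq> A'}"
  proof (intro equalityI subsetI)
    fix e assume "e \<in> {e \<in> edges H. e \<subseteq> B'}"
    then have e: "e \<in> edges H" "e \<subseteq> \<sigma> ` A'" and "e \<in> {e \<in> edges H. e \<subseteq> B}" using BH B' by auto
    then obtain d where d: "d \<in> edges G" "d \<subseteq> A" "e = \<sigma> ` d" unfolding E by blast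
    have "d \<subseteq> verts G" using G d(1) by (auto simp: network_def)
    then have "d \<subseteq> A'"
      using inj_on_image_subset_iff[OF inj, of d A'] A' d e(2) by blast
    then show "e \<in> (\<lambda>e. \<sigma> ` e) ` {e \<in> edges G. e \<subseteq> A'}" using d by blast
  next
    fix e assume "e \<in> (\<lambda>e. \<sigma> ` e) ` {e \<in> edges G. e \<subseteq> A'}"
    then obtain d where d: "d \<in> edges G" "d \<subseteq> A'" "e = \<sigma> ` d" by blast
    then have "e \<in> {e \<in> edges H. e \<subseteq> B}" unfolding E using A' by blast
    then show "e \<in> {e \<in> edges H. e \<subseteq> B'}" using d B' by blast
  qed
  moreover have "verts G \<inter> A' = A'" "verts H \<inter> B' = B'" using A' BH by auto
  ultimately show ?thesis
    using vm em A' by (simp add: net_iso_def induced_def subset_iff)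
qed

text \<open>With \<open>S = {p}\<close> and \<open>S = {p, p'}\<close> this is the relation behind
  \<open>rcyl\<close> and \<open>dcyl\<close>. The roots in \<open>H\<close> are not parameters but
  images under \<sigma>, so that such maps compose without side conditions on roots.\<close>

definition ball_iso :: "nat \<Rightarrow> (nat \<Rightarrow> nat) \<Rightarrow> net \<Rightarrow> nat set \<Rightarrow> net \<Rightarrow> bool" where
  "ball_iso r \<sigma> G S H \<longleftrightarrow>
     net_iso \<sigma> (induced G (nball G r S)) (induced H (nball H r (\<sigma> ` S)))"

lemma ball_iso_refl: "ball_iso r id G S G"
  by (simp add: ball_iso_def net_iso_refl)

lemma ball_iso_trans:
  "ball_iso r \<sigma> G S H \<Longrightarrow> ball_iso r \<tau> H (\<sigma> ` S) K \<Longrightarrow> ball_iso r (\<tau> \<circ> \<sigma>) G S K"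
  unfolding ball_iso_def by (metis image_comp net_iso_trans)

text \<open>By the triangle inequality the \<open>r\<close>-balls around \<open>S'\<close> and
  around its image lie in the \<open>s\<close>-balls that \<sigma> matches; in \<open>H\<close> this
  uses that \<sigma> carries the \<open>t\<close>-ball onto the \<open>t\<close>-ball. With
  \<open>t = 0\<close> this shrinks the radius or drops a root; with \<open>t = R\<close> it allows
  a second root anywhere in the \<open>R\<close>-ball.\<close>

lemma ball_iso_restrict:
  assumes G: "network G" and H: "network H" and iso: "ball_iso s \<sigma> G S H"
    and S: "S \<subseteq> verts G" and S': "S' \<subseteq> nball G t S" and le: "t + r \<le> s"
  shows "ball_iso r \<sigma> G S' H" "\<sigma> ` nball G r S' = nball H r (\<sigma> ` S')"
proof -
  have iso': "net_iso \<sigma> (induced G (nball G s S)) (induced H (nball H s (\<sigma> ` S)))"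
    using iso by (simp add: ball_iso_def)
  have "S \<subseteq> nball G s S" using nball_0[OF S] nball_mono[of 0 s S S G] by simp
  moreover have "nball G t S \<subseteq> nball G s S" "nball H t (\<sigma> ` S) \<subseteq> nball H s (\<sigma> ` S)"
    using le by (simp_all add: nball_mono)
  ultimately have "\<sigma> ` nball G t S = nball H t (\<sigma> ` S)"
    using nball_image[OF G H iso' S, of t] by simp
  then have T': "\<sigma> ` S' \<subseteq> nball H t (\<sigma> ` S)" using S' by blast
  have sG: "nball G r S' \<subseteq> nball G s S"
    using nball_mono[OF order_refl S'] nball_nball[of G r t S] nball_mono[OF le order_refl[of S]]
    by blast
  have sH: "nball H r (\<sigma> ` S') \<subseteq> nball H s (\<sigma> ` S)"
    using nball_mono[OF order_refl T'] nball_nball[of H r t "\<sigma> ` S"]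
      nball_mono[OF le order_refl[of "\<sigma> ` S"]] by blast
  have "S' \<subseteq> nball G s S"
    using S' \<open>nball G t S \<subseteq> nball G s S\<close> by blast
  moreover have "S' \<subseteq> verts G" using S' nball_subset_verts by blast
  ultimately show im: "\<sigma> ` nball G r S' = nball H r (\<sigma> ` S')"
    using nball_image[OF G H iso' _ _ sG sH] by blast
  show "ball_iso r \<sigma> G S' H"
    unfolding ball_iso_def
    by (rule net_iso_subset[OF G iso' sG nball_subset_verts im])
qed

lemma induced_UNIV [simp]: "induced G UNIV = G"
  by (simp add: induced_def)

text \<open>A full isomorphism is one between the subgraphs induced by \<open>UNIV\<close>, which
  contain all balls.\<close>

lemma net_iso_imp_ball_iso:
  assumes "network G" "network H" "net_iso \<sigma> G H" "S \<subseteq> verts G"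
  shows "ball_iso r \<sigma> G S H"
proof -
  have iso: "net_iso \<sigma> (induced G UNIV) (induced H UNIV)" using assms by simp
  show ?thesis
    unfolding ball_iso_def
    using nball_image[OF assms(1,2) iso assms(4)]
    by (intro net_iso_subset[OF assms(1) iso _ nball_subset_verts]) auto
qed

section \<open>Representatives of isomorphism classes and membership in cylinders\<close>

lemma rnet_exhaust:
  obtains G p where "rep_rnet x = (G, p)" "x = abs_rnet (G, p)" "network G" "p \<in> verts G"
proof -
  obtain G p where Gp: "rep_rnet x = (G, p)" by (cases "rep_rnet x")
  \<comment> \<open>\<open>rooted_iso\<close> is reflexive exactly at the pairs of a network and one
    of its vertices, so the chosen representative is such a pair.\<close>
  have "rooted_iso (G, p) (G, p)"
    using Quotient_rep_reflp[OF Quotient_rnet, of x] Gp by simp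
  moreover have "x = abs_rnet (G, p)"
    using Quotient_abs_rep[OF Quotient_rnet, of x] Gp by simp
  ultimately show thesis using that Gp by (auto simp: rooted_iso_def)
qed

lemma dnet_exhaust:
  obtains G p p' where "rep_dnet x = (G, p, p')" "x = abs_dnet (G, p, p')" "network G"
    "p \<in> verts G" "p' \<in> verts G"
proof -
  obtain G p p' where Gp: "rep_dnet x = (G, p, p')" by (cases "rep_dnet x")
  have "birooted_iso (G, p, p') (G, p, p')"
    using Quotient_rep_reflp[OF Quotient_dnet, of x] Gp by simp
  moreover have "x = abs_dnet (G, p, p')"
    using Quotient_abs_rep[OF Quotient_dnet, of x] Gp by simp
  ultimately show thesis using that Gp by (auto simp: birooted_iso_def)
qed

lemma abs_rnet_eqD:
  assumes "abs_rnet (G, p) = abs_rnet (H, q)" "network G" "p \<in> verts G" "network H" "q \<in> verts H"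
  obtains \<sigma> where "net_iso \<sigma> G H" "\<sigma> p = q"
proof -
  have "rooted_iso (K, a) (K, a)" if "network K" "a \<in> verts K" for K a
    using that by (auto simp: rooted_iso_def intro: exI[of _ id] net_iso_refl)
  then have "rooted_iso (G, p) (H, q)"
    using Quotient_rel[OF Quotient_rnet, of "(G, p)" "(H, q)"] assms by blast
  then show thesis using that by (auto simp: rooted_iso_def)
qed

lemma abs_dnet_eqD:
  assumes "abs_dnet (G, p, p') = abs_dnet (H, q, q')" "network G" "p \<in> verts G" "p' \<in> verts G"
    "network H" "q \<in> verts H" "q' \<in> verts H"
  obtains \<sigma> where "net_iso \<sigma> G H" "\<sigma> p = q" "\<sigma> p' = q'"
proof -
  have "birooted_iso (K, a, b) (K, a, b)" if "network K" "a \<in> verts K" "b \<in> verts K" for K a b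
    using that by (auto simp: birooted_iso_def intro: exI[of _ id] net_iso_refl)
  then have "birooted_iso (G, p, p') (H, q, q')"
    using Quotient_rel[OF Quotient_dnet, of "(G, p, p')" "(H, q, q')"] assms by blast
  then show thesis using that by (auto simp: birooted_iso_def)
qed

text \<open>Membership in \<open>rcyl\<close> asks for some representative. Two representatives
  differ by a full isomorphism, which restricts to balls, so membership can be tested on whichever
  representative is at hand.\<close>

lemma abs_in_rcyl_iff:
  assumes H: "network H" "q \<in> verts H"
  shows "abs_rnet (H, q) \<in> rcyl r G p \<longleftrightarrow> (\<exists>\<sigma>. ball_iso r \<sigma> G {p} H \<and> \<sigma> p = q)"
proof
  assume "abs_rnet (H, q) \<in> rcyl r G p"
  then obtain K k \<sigma> where K: "abs_rnet (K, k) = abs_rnet (H, q)" "network K" "k \<in> verts K"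
    "ball_iso r \<sigma> G {p} K" "\<sigma> p = k"
    unfolding rcyl_def ball_iso_def by auto
  obtain \<tau> where \<tau>: "net_iso \<tau> K H" "\<tau> k = q" using abs_rnet_eqD[OF K(1-3) H] .
  have "ball_iso r \<tau> K (\<sigma> ` {p}) H"
    using K H \<tau> by (intro net_iso_imp_ball_iso) auto
  then show "\<exists>\<sigma>. ball_iso r \<sigma> G {p} H \<and> \<sigma> p = q"
    using ball_iso_trans[OF K(4)] K(5) \<tau>(2) by (intro exI[of _ "\<tau> \<circ> \<sigma>"]) simp
next
  assume "\<exists>\<sigma>. ball_iso r \<sigma> G {p} H \<and> \<sigma> p = q"
  then show "abs_rnet (H, q) \<in> rcyl r G p"
    unfolding rcyl_def ball_iso_def using H by auto
qed

lemma abs_in_dcyl_iff: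
  assumes H: "network H" "q \<in> verts H" "q' \<in> verts H"
  shows "abs_dnet (H, q, q') \<in> dcyl r G p p' \<longleftrightarrow>
    (\<exists>\<sigma>. ball_iso r \<sigma> G {p, p'} H \<and> \<sigma> p = q \<and> \<sigma> p' = q')"
proof
  assume "abs_dnet (H, q, q') \<in> dcyl r G p p'"
  then obtain K k k' \<sigma> where K: "abs_dnet (K, k, k') = abs_dnet (H, q, q')" "network K"
    "k \<in> verts K" "k' \<in> verts K" "ball_iso r \<sigma> G {p, p'} K" "\<sigma> p = k" "\<sigma> p' = k'"
    unfolding dcyl_def ball_iso_def by auto
  obtain \<tau> where \<tau>: "net_iso \<tau> K H" "\<tau> k = q" "\<tau> k' = q'" using abs_dnet_eqD[OF K(1-4) H] .
  have "ball_iso r \<tau> K (\<sigma> ` {p, p'}) H"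
    using K H \<tau> by (intro net_iso_imp_ball_iso) auto
  then show "\<exists>\<sigma>. ball_iso r \<sigma> G {p, p'} H \<and> \<sigma> p = q \<and> \<sigma> p' = q'"
    using ball_iso_trans[OF K(5)] K(6,7) \<tau>(2,3) by (intro exI[of _ "\<tau> \<circ> \<sigma>"]) simp
next
  assume "\<exists>\<sigma>. ball_iso r \<sigma> G {p, p'} H \<and> \<sigma> p = q \<and> \<sigma> p' = q'"
  then show "abs_dnet (H, q, q') \<in> dcyl r G p p'"
    unfolding dcyl_def ball_iso_def using H by auto
qed

section \<open>Cylinders as a base of the local topology\<close>

lemma abs_in_rcyl: "network G \<Longrightarrow> p \<in> verts G \<Longrightarrow> abs_rnet (G, p) \<in> rcyl r G p"
  using ball_iso_refl[of r G "{p}"] by (auto simp: abs_in_rcyl_iff)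

lemma abs_in_dcyl:
  "network G \<Longrightarrow> p \<in> verts G \<Longrightarrow> p' \<in> verts G \<Longrightarrow> abs_dnet (G, p, p') \<in> dcyl r G p p'"
  using ball_iso_refl[of r G "{p, p'}"] by (auto simp: abs_in_dcyl_iff)

lemma open_rcyl: "network G \<Longrightarrow> p \<in> verts G \<Longrightarrow> open (rcyl r G p)"
  unfolding open_rnet_def by (rule generate_topology.Basis) blast

lemma open_dcyl: "network G \<Longrightarrow> p \<in> verts G \<Longrightarrow> p' \<in> verts G \<Longrightarrow> open (dcyl r G p p')"
  unfolding open_dnet_def by (rule generate_topology.Basis) blast

text \<open>As in an ultrametric space, every point of a cylinder is a centre of it: an isomorphism
  of \<open>s\<close>-balls shrinks to the \<open>r\<close>-balls and composes with the one that put
  \<open>(H, q, q')\<close> into the first cylinder.\<close>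

lemma dcyl_subset:
  assumes "network G" "network H" "p \<in> verts G" "p' \<in> verts G" "q \<in> verts H" "q' \<in> verts H"
    and "abs_dnet (H, q, q') \<in> dcyl r G p p'" "r \<le> s"
  shows "dcyl s H q q' \<subseteq> dcyl r G p p'"
proof
  fix x assume x: "x \<in> dcyl s H q q'"
  obtain K k k' where K: "x = abs_dnet (K, k, k')" "network K" "k \<in> verts K" "k' \<in> verts K"
    using dnet_exhaust[of x] by metis
  obtain \<tau> where \<tau>: "ball_iso s \<tau> H {q, q'} K" "\<tau> q = k" "\<tau> q' = k'"
    using x K by (auto simp: abs_in_dcyl_iff)
  obtain \<sigma> where \<sigma>: "ball_iso r \<sigma> G {p, p'} H" "\<sigma> p = q" "\<sigma> p' = q'"
    using assms by (auto simp: abs_in_dcyl_iff)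
  have "ball_iso r \<tau> H (\<sigma> ` {p, p'}) K"
    using assms \<sigma> nball_0[of "{q, q'}" H]
    by (intro ball_iso_restrict(1)[OF assms(2) K(2) \<tau>(1), where t = 0]) auto
  then show "x \<in> dcyl r G p p'"
    using ball_iso_trans[OF \<sigma>(1)] \<sigma>(2,3) \<tau>(2,3) K
    by (auto simp: abs_in_dcyl_iff intro!: exI[of _ "\<tau> \<circ> \<sigma>"])
qed


section \<open>Measurability of sums over the second root\<close>

text \<open>These are the unions of cylinders of one common radius. The uniform radius, which an
  open set need not have, is what lets a sum over an \<open>R\<close>-ball depend on a ball of
  bounded radius.\<close>

definition ball_determined :: "nat \<Rightarrow> dnet set \<Rightarrow> bool" where
  "ball_determined r D \<longleftrightarrow>
     (\<forall>G p p'. network G \<longrightarrow> p \<in> verts G \<longrightarrow> p' \<in> verts G \<longrightarrow> abs_dnet (G, p, p') \<in> D \<longrightarrow>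
        dcyl r G p p' \<subseteq> D)"

lemma dcyl_antimono:
  assumes "network G" "p \<in> verts G" "p' \<in> verts G" "r \<le> s"
  shows "dcyl s G p p' \<subseteq> dcyl r G p p'"
  using assms by (intro dcyl_subset abs_in_dcyl) auto

lemma ball_determined_mono:
  assumes "ball_determined r D" "r \<le> s"
  shows "ball_determined s D"
  unfolding ball_determined_def
proof (intro allI impI)
  fix G p p' assume *: "network G" "p \<in> verts G" "p' \<in> verts G" "abs_dnet (G, p, p') \<in> D"
  then have "dcyl r G p p' \<subseteq> D" using assms(1) by (auto simp: ball_determined_def)
  then show "dcyl s G p p' \<subseteq> D" using dcyl_antimono[OF *(1-3) assms(2)] by blast
qed

lemma ball_determined_Int:
  "ball_determined r D \<Longrightarrow> ball_determined r E \<Longrightarrow> ball_determined r (D \<inter> E)"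
  by (simp add: ball_determined_def)

lemma openI_dcyl:
  assumes "\<And>G p p'. network G \<Longrightarrow> p \<in> verts G \<Longrightarrow> p' \<in> verts G \<Longrightarrow> abs_dnet (G, p, p') \<in> U \<Longrightarrow>
    \<exists>r. dcyl r G p p' \<subseteq> U"
  shows "open U"
proof -
  have "\<exists>T. open T \<and> x \<in> T \<and> T \<subseteq> U" if x: "x \<in> U" for x
  proof -
    obtain G p p' where G: "x = abs_dnet (G, p, p')" "network G" "p \<in> verts G" "p' \<in> verts G"
      using dnet_exhaust[of x] by metis
    then obtain r where "dcyl r G p p' \<subseteq> U" using assms x by blast
    then show ?thesis
      using abs_in_dcyl[OF G(2-4)] open_dcyl[OF G(2-4)] G(1) by (intro exI[of _ "dcyl r G p p'"]) simp
  qed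
  then show ?thesis by (rule topological_space_class.openI)
qed

text \<open>The cylinders are given as a subbase but form a base: an intersection is handled by the
  larger of two radii, a generator by recentring it at the given point.\<close>

lemma openD_dcyl:
  assumes "open U" "network G" "p \<in> verts G" "p' \<in> verts G" "abs_dnet (G, p, p') \<in> U"
  shows "\<exists>r. dcyl r G p p' \<subseteq> U"
proof -
  have "generate_topology {dcyl r G p p' | r G p p'. network G \<and> p \<in> verts G \<and> p' \<in> verts G} U"
    using assms(1) by (simp add: open_dnet_def)
  then show ?thesis using assms(5)
  proof induction
    case (Int a b)
    then obtain r s where "dcyl r G p p' \<subseteq> a" "dcyl s G p p' \<subseteq> b" by blast
    moreover have "dcyl (max r s) G p p' \<subseteq> dcyl r G p p'" "dcyl (max r s) G p p' \<subseteq> dcyl s G p p'"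
      using dcyl_antimono[OF assms(2-4)] by simp_all
    ultimately show ?case by blast
  next
    case (Basis S)
    then obtain r H q q' where H: "S = dcyl r H q q'" "network H" "q \<in> verts H" "q' \<in> verts H"
      by blast
    then show ?case
      using dcyl_subset[of H G q q' p p' r r] assms(2-4) Basis by (intro exI[of _ r]) simp
  next
    case (UN K)
    then obtain k where "k \<in> K" "abs_dnet (G, p, p') \<in> k" by blast
    then obtain r where "dcyl r G p p' \<subseteq> k" using UN by blast
    then show ?case using \<open>k \<in> K\<close> by blast
  qed simp
qed

text \<open>Provides the generator for the Dynkin argument below: its members have a uniform radius,
  and passing to the larger radius shows that it is stable under intersection.\<close>

lemma borel_dnet_eq: "sets (borel :: dnet measure) = sigma_sets UNIV {D. \<exists>r. ball_determined r D}"
proof -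
  have "sigma_sets UNIV {S. open S} = sigma_sets UNIV {D. \<exists>r. ball_determined r D}"
  proof (rule sigma_sets_eqI)
    fix U :: "dnet set" assume "U \<in> {S. open S}"
    then have U: "open U" by simp
    \<comment> \<open>Arbitrary unions of cylinders become countable ones: group the points of \<open>U\<close> by a
      radius at which their cylinder lies inside \<open>U\<close>.\<close>
    define I where "I r = {abs_dnet (G, p, p') | G p p'.
      network G \<and> p \<in> verts G \<and> p' \<in> verts G \<and> dcyl r G p p' \<subseteq> U}" for r
    have I: "ball_determined r (I r)" for r
      unfolding ball_determined_def
    proof (intro allI impI subsetI)
      fix G p p' x
      assume G: "network G" "p \<in> verts G" "p' \<in> verts G" "abs_dnet (G, p, p') \<in> I r"
        and x: "x \<in> dcyl r G p p'"
      obtain H q q' where H: "x = abs_dnet (H, q, q')" "network H" "q \<in> verts H" "q' \<in> verts H"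
        using dnet_exhaust[of x] by metis
      \<comment> \<open>Membership in \<open>I r\<close> speaks of some representative
        \<open>K\<close>, possibly other than \<open>G\<close>. Recentring first at \<open>G\<close>
        and then at \<open>H\<close> keeps the cylinder inside \<open>U\<close>.\<close>
      obtain K k k' where K: "abs_dnet (G, p, p') = abs_dnet (K, k, k')" "network K" "k \<in> verts K"
        "k' \<in> verts K" "dcyl r K k k' \<subseteq> U"
        using G(4) unfolding I_def by blast
      have "dcyl r G p p' \<subseteq> dcyl r K k k'"
        using dcyl_subset[of K G k k' p p' r r] K G abs_in_dcyl[OF K(2-4)] by simp
      moreover have "dcyl r H q q' \<subseteq> dcyl r G p p'"
        using dcyl_subset[of G H p p' q q' r r] H G x by simp
      ultimately show "x \<in> I r" unfolding I_def using K(5) H by blast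
    qed
    have "I r \<in> sigma_sets UNIV {D. \<exists>r. ball_determined r D}" for r
      by (rule sigma_sets.Basic, rule CollectI, rule exI, rule I)
    then have "(\<Union>r. I r) \<in> sigma_sets UNIV {D. \<exists>r. ball_determined r D}"
      by (rule sigma_sets.Union)
    moreover have "U = (\<Union>r. I r)"
    proof (intro equalityI subsetI)
      fix x assume x: "x \<in> U"
      obtain G p p' where G: "x = abs_dnet (G, p, p')" "network G" "p \<in> verts G" "p' \<in> verts G"
        using dnet_exhaust[of x] by metis
      obtain r where "dcyl r G p p' \<subseteq> U" using openD_dcyl[OF U G(2-4)] x G(1) by blast
      then have "x \<in> I r" using G unfolding I_def by blast
      then show "x \<in> (\<Union>r. I r)" by blast
    next
      fix x assume "x \<in> (\<Union>r. I r)"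
      then obtain r G p p' where "x = abs_dnet (G, p, p')" "network G" "p \<in> verts G" "p' \<in> verts G"
        "dcyl r G p p' \<subseteq> U"
        unfolding I_def by blast
      then show "x \<in> U" using abs_in_dcyl[of G p p' r] by blast
    qed
    ultimately show "U \<in> sigma_sets UNIV {D. \<exists>r. ball_determined r D}"
      by (simp only:)
  next
    fix D :: "dnet set" assume "D \<in> {D. \<exists>r. ball_determined r D}"
    then obtain r where r: "ball_determined r D" by blast
    have "open D"
    proof (rule openI_dcyl)
      fix G p p' assume "network G" "p \<in> verts G" "p' \<in> verts G" "abs_dnet (G, p, p') \<in> D"
      then have "dcyl r G p p' \<subseteq> D" using r by (simp add: ball_determined_def)
      then show "\<exists>r. dcyl r G p p' \<subseteq> D" ..
    qed
    then show "D \<in> sigma_sets UNIV {S. open S}" by (intro sigma_sets.Basic CollectI)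
  qed
  moreover have "sets (borel :: dnet measure) = sigma_sets UNIV {S. open S}"
    unfolding borel_def by (rule sets_measure_of) simp
  ultimately show ?thesis by (simp only:)
qed

text \<open>
  The sum over the whole network may be infinite, which breaks the complement step of a Dynkin
  argument.  Summing over a ball keeps it finite; \<open>root_sum\<close> below is the increasing limit.
\<close>

definition ball_sum :: "nat \<Rightarrow> (dnet \<Rightarrow> ennreal) \<Rightarrow> rnet \<Rightarrow> ennreal" where
  "ball_sum R g x = (case rep_rnet x of (G, p) \<Rightarrow>
     \<integral>\<^sup>+u. g (abs_dnet (G, p, u)) \<partial>count_space (nball G R {p}))"

text \<open>Isomorphic \<open>(R + r)\<close>-balls have their \<open>R\<close>-balls in bijection,
  and for each \<open>u\<close> in the \<open>R\<close>-ball they contain the \<open>r\<close>-ball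
  around both roots, which decides membership in \<open>D\<close>.\<close>

lemma ball_sum_le_rcyl:
  assumes D: "ball_determined r D" and x: "rep_rnet x = (G, p)" "network G" "p \<in> verts G"
    and y: "y \<in> rcyl (R + r) G p"
  shows "ball_sum R (indicator D) x \<le> ball_sum R (indicator D) y"
proof -
  obtain H q where H: "rep_rnet y = (H, q)" "y = abs_rnet (H, q)" "network H" "q \<in> verts H"
    using rnet_exhaust[of y] .
  obtain \<sigma> where \<sigma>: "ball_iso (R + r) \<sigma> G {p} H" "\<sigma> p = q"
    using y H by (auto simp: abs_in_rcyl_iff)
  let ?B = "nball G R {p}"
  have pB: "p \<in> ?B" using x(3) by (auto simp: nball_def intro: exI[of _ 0])
  have im: "\<sigma> ` ?B = nball H R {q}"
    using ball_iso_restrict(2)[OF x(2) H(3) \<sigma>(1), of "{p}" 0 R] x(3) \<sigma>(2) nball_0[of "{p}" G]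
    by simp
  have "inj_on \<sigma> (nball G (R + r) {p})"
    using \<sigma>(1) nball_subset_verts[of G "R + r" "{p}"]
    by (auto simp: ball_iso_def net_iso_def induced_def bij_betw_def Int_absorb1)
  then have "inj_on \<sigma> ?B"
    by (rule inj_on_subset) (simp add: nball_mono)
  then have bij: "bij_betw \<sigma> ?B (nball H R {q})" using im by (simp add: bij_betw_def)
  have "abs_dnet (H, q, \<sigma> u) \<in> D" if u: "u \<in> ?B" "abs_dnet (G, p, u) \<in> D" for u
  proof -
    have uG: "u \<in> verts G" using u(1) nball_subset_verts by blast
    have "\<sigma> u \<in> verts H" using u(1) im nball_subset_verts[of H R "{q}"] by blast
    moreover have "ball_iso r \<sigma> G {p, u} H"
      using ball_iso_restrict(1)[OF x(2) H(3) \<sigma>(1), of "{p, u}" R r] x(3) u(1) pB by simp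
    ultimately have "abs_dnet (H, q, \<sigma> u) \<in> dcyl r G p u"
      using \<sigma>(2) H by (auto simp: abs_in_dcyl_iff)
    then show ?thesis using D x uG u(2) unfolding ball_determined_def by blast
  qed
  then have "ball_sum R (indicator D) x
      \<le> (\<integral>\<^sup>+u. indicator D (abs_dnet (H, q, \<sigma> u)) \<partial>count_space ?B)"
    unfolding ball_sum_def x(1) by (auto intro!: nn_integral_mono simp: indicator_def)
  also have "\<dots> = ball_sum R (indicator D) y"
    unfolding ball_sum_def H(1) prod.case using bij by (rule nn_integral_bij_count_space)
  finally show ?thesis .
qed

text \<open>Lower semicontinuity: a superlevel set contains, with each of its points, the cylinder
  of radius \<open>R + r\<close> around it, and is therefore open.\<close>

lemma measurable_ball_sum_determined:
  assumes D: "ball_determined r D"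
  shows "ball_sum R (indicator D) \<in> borel_measurable borel"
proof (rule borel_measurableI_greater)
  fix c
  have "open {x. c < ball_sum R (indicator D) x}"
  proof (rule topological_space_class.openI)
    fix x assume x: "x \<in> {x. c < ball_sum R (indicator D) x}"
    obtain G p where G: "rep_rnet x = (G, p)" "x = abs_rnet (G, p)" "network G" "p \<in> verts G"
      using rnet_exhaust[of x] .
    have "rcyl (R + r) G p \<subseteq> {x. c < ball_sum R (indicator D) x}"
      using ball_sum_le_rcyl[OF D G(1,3,4), of _ R] x by (auto intro: less_le_trans)
    then show "\<exists>T. open T \<and> x \<in> T \<and> T \<subseteq> {x. c < ball_sum R (indicator D) x}"
      using open_rcyl[OF G(3,4)] abs_in_rcyl[OF G(3,4)] G(2) by blast
  qed
  then show "{x \<in> space borel. c < ball_sum R (indicator D) x} \<in> sets borel" by simp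
qed

text \<open>As a counting measure, the ball sum turns complements into differences and disjoint
  unions into series.\<close>

lemma ball_sum_indicator:
  assumes "rep_rnet x = (G, p)"
  shows "ball_sum R (indicator D) x =
    emeasure (count_space (nball G R {p})) {u \<in> nball G R {p}. abs_dnet (G, p, u) \<in> D}"
proof -
  have "ball_sum R (indicator D) x = (\<integral>\<^sup>+u. indicator {u \<in> nball G R {p}. abs_dnet (G, p, u) \<in> D} u
      \<partial>count_space (nball G R {p}))"
    unfolding ball_sum_def assms by (auto intro!: nn_integral_cong simp: indicator_def)
  then show ?thesis by (simp add: nn_integral_indicator)
qed

lemma measurable_ball_sum_indicator:
  assumes "D \<in> sets borel"
  shows "ball_sum R (indicator D) \<in> borel_measurable borel"
proof -
  let ?G = "{D. \<exists>r. ball_determined r D}"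
  have "Int_stable ?G"
  proof (rule Int_stableI)
    fix a b assume "a \<in> ?G" "b \<in> ?G"
    then obtain r s where "ball_determined r a" "ball_determined s b" by blast
    then have "ball_determined (max r s) a" "ball_determined (max r s) b"
      by (auto intro: ball_determined_mono)
    then show "a \<inter> b \<in> ?G" using ball_determined_Int by blast
  qed
  moreover have "?G \<subseteq> Pow UNIV" by simp
  moreover have "D \<in> sigma_sets UNIV ?G" using assms by (simp add: borel_dnet_eq)
  ultimately show ?thesis
  proof (induction rule: sigma_sets_induct_disjoint)
    case (basic A)
    then show ?case using measurable_ball_sum_determined by blast
  next
    case empty
    have "ball_determined 0 {}" by (simp add: ball_determined_def)
    then show ?case by (rule measurable_ball_sum_determined)
  next
    case (compl A)
    have "ball_determined 0 UNIV" by (simp add: ball_determined_def)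
    then have U: "ball_sum R (indicator UNIV) \<in> borel_measurable borel"
      by (rule measurable_ball_sum_determined)
    have "ball_sum R (indicator (UNIV - A)) =
        (\<lambda>x. ball_sum R (indicator UNIV) x - ball_sum R (indicator A) x)"
    proof
      fix x
      obtain G p where G: "rep_rnet x = (G, p)" "x = abs_rnet (G, p)" "network G" "p \<in> verts G"
        using rnet_exhaust[of x] .
      \<comment> \<open>Subtracting measures requires the measure of the removed set to be
        finite.\<close>
      have "finite (nball G R {p})" using G by (intro finite_nball) auto
      then show "ball_sum R (indicator (UNIV - A)) x =
          ball_sum R (indicator UNIV) x - ball_sum R (indicator A) x"
        unfolding ball_sum_indicator[OF G(1)]
        by (subst emeasure_Diff[symmetric]) (auto intro!: arg_cong[where f = card])
    qed
    then show ?case using U compl.IH by simp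
  next
    case (union A)
    have "ball_sum R (indicator (\<Union>i. A i)) = (\<lambda>x. \<Sum>i. ball_sum R (indicator (A i)) x)"
    proof
      fix x
      obtain G p where G: "rep_rnet x = (G, p)" by (cases "rep_rnet x")
      have "disjoint_family (\<lambda>i. {u \<in> nball G R {p}. abs_dnet (G, p, u) \<in> A i})"
        using union.hyps unfolding disjoint_family_on_def by blast
      then show "ball_sum R (indicator (\<Union>i. A i)) x = (\<Sum>i. ball_sum R (indicator (A i)) x)"
        unfolding ball_sum_indicator[OF G]
        by (subst suminf_emeasure) (auto intro!: arg_cong2[where f = emeasure])
    qed
    then show ?case using union.IH by simp
  qed
qed

lemma measurable_ball_sum:
  assumes "g \<in> borel_measurable borel"
  shows "ball_sum R g \<in> borel_measurable borel"
  using assms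
proof (induction rule: borel_measurable_induct)
  case (cong f g)
  then have "f = g" by auto
  then show ?case using cong by simp
next
  case (set A)
  then show ?case by (rule measurable_ball_sum_indicator)
next
  case (mult u c)
  have "ball_sum R (\<lambda>x. c * u x) = (\<lambda>x. c * ball_sum R u x)"
    by (auto simp: ball_sum_def nn_integral_cmult split: prod.split)
  then show ?case using mult by simp
next
  case (add u v)
  have "ball_sum R (\<lambda>x. v x + u x) = (\<lambda>x. ball_sum R v x + ball_sum R u x)"
    by (auto simp: ball_sum_def nn_integral_add split: prod.split)
  then show ?case using add by simp
next
  case (seq U)
  have "ball_sum R (\<Squnion> (range U)) = (\<lambda>x. SUP i. ball_sum R (U i) x)"
  proof
    fix x
    obtain G p where G: "rep_rnet x = (G, p)" by (cases "rep_rnet x")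
    show "ball_sum R (SUP i. U i) x = (SUP i. ball_sum R (U i) x)"
      unfolding ball_sum_def G prod.case SUP_apply
      by (rule nn_integral_monotone_convergence_SUP)
        (use seq.hyps in \<open>auto simp: incseq_def le_fun_def\<close>)
  qed
  then show ?case
    by (elim ssubst) (rule borel_measurable_SUP[OF _ seq.IH], simp)
qed

definition root_sum :: "(dnet \<Rightarrow> ennreal) \<Rightarrow> rnet \<Rightarrow> ennreal" where
  "root_sum g x = (case rep_rnet x of (G, p) \<Rightarrow>
     \<integral>\<^sup>+u. g (abs_dnet (G, p, u)) \<partial>count_space (verts G))"

text \<open>The balls around the root exhaust the network, so monotone convergence applies;
  measurability then passes from ball sums to the full sum.\<close>

lemma root_sum_eq_SUP: "root_sum g x = (SUP R. ball_sum R g x)"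
proof -
  obtain G p where G: "rep_rnet x = (G, p)" "x = abs_rnet (G, p)" "network G" "p \<in> verts G"
    using rnet_exhaust[of x] .
  let ?g = "\<lambda>u. g (abs_dnet (G, p, u))"
  have "root_sum g x = (\<integral>\<^sup>+u. ?g u * indicator (verts G) u \<partial>count_space UNIV)"
    unfolding root_sum_def G(1) by (simp add: nn_integral_count_space_indicator)
  also have "\<dots> = (\<integral>\<^sup>+u. (SUP R. ?g u * indicator (nball G R {p}) u) \<partial>count_space UNIV)"
  proof (rule nn_integral_cong)
    fix u
    show "?g u * indicator (verts G) u = (SUP R. ?g u * indicator (nball G R {p}) u)"
    proof (cases "u \<in> verts G")
      case True
      then obtain R where "u \<in> nball G R {p}" using verts_exhausted[OF G(3,4)] by blast
      then show ?thesis using True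
        \<comment> \<open>The supremum is attained at any radius whose ball contains
          \<open>u\<close>.\<close>
        by (intro antisym SUP_least SUP_upper2[of R]) (auto simp: indicator_def)
    next
      case False
      then have "u \<notin> nball G R {p}" for R using nball_subset_verts by blast
      then show ?thesis using False by simp
    qed
  qed
  also have "\<dots> = (SUP R. \<integral>\<^sup>+u. ?g u * indicator (nball G R {p}) u \<partial>count_space UNIV)"
  proof (rule nn_integral_monotone_convergence_SUP)
    show "incseq (\<lambda>R u. ?g u * indicator (nball G R {p}) u)"
      using nball_mono[of _ _ "{p}" "{p}" G]
      by (fastforce simp: incseq_def le_fun_def indicator_def)
  qed simp
  also have "\<dots> = (SUP R. ball_sum R g x)"
    unfolding ball_sum_def G(1) by (simp add: nn_integral_count_space_indicator)
  finally show ?thesis .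
qed

lemma measurable_root_sum [measurable]:
  "g \<in> borel_measurable borel \<Longrightarrow> root_sum g \<in> borel_measurable borel"
  unfolding root_sum_eq_SUP[abs_def] by (intro borel_measurable_SUP measurable_ball_sum) auto

lemma root_sum_abs:
  assumes "network G" "p \<in> verts G"
  shows "root_sum g (abs_rnet (G, p)) =
    (\<integral>\<^sup>+u. g (abs_dnet (G, p, u)) \<partial>count_space (verts G))"
proof -
  obtain H q \<sigma> where H: "rep_rnet (abs_rnet (G, p)) = (H, q)" "network H" "q \<in> verts H"
    "net_iso \<sigma> H G" "\<sigma> q = p"
    using rep_rnet_absE[OF assms] .
  have "(\<integral>\<^sup>+u. g (abs_dnet (H, q, u)) \<partial>count_space (verts H)) =
      (\<integral>\<^sup>+u. g (abs_dnet (G, p, \<sigma> u)) \<partial>count_space (verts H))"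
    using H(5) abs_dnet_eqI[OF H(2) assms(1) _ _ H(4)] H(3) by (intro nn_integral_cong) simp
  also have "\<dots> = (\<integral>\<^sup>+u. g (abs_dnet (G, p, u)) \<partial>count_space (verts G))"
    using H(4) by (intro nn_integral_bij_count_space) (simp add: net_iso_def)
  finally show ?thesis by (simp add: root_sum_def H(1))
qed

text \<open>Exchanging roots turns incoming into outgoing mass, so that \<open>root_sum\<close>
  serves for both. Together with \<open>root_fst\<close> it also gives access to the network rooted
  at the second root.\<close>

definition swap_roots :: "dnet \<Rightarrow> dnet" where
  "swap_roots y = (case rep_dnet y of (G, p, p') \<Rightarrow> abs_dnet (G, p', p))"

definition root_fst :: "dnet \<Rightarrow> rnet" where
  "root_fst y = (case rep_dnet y of (G, p, p') \<Rightarrow> abs_rnet (G, p))"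

lemma
  assumes "network G" "p \<in> verts G" "p' \<in> verts G"
  shows swap_roots_abs: "swap_roots (abs_dnet (G, p, p')) = abs_dnet (G, p', p)"
    and root_fst_abs: "root_fst (abs_dnet (G, p, p')) = abs_rnet (G, p)"
proof -
  obtain H q q' where H: "rep_dnet (abs_dnet (G, p, p')) = (H, q, q')"
    "abs_dnet (G, p, p') = abs_dnet (H, q, q')" "network H" "q \<in> verts H" "q' \<in> verts H"
    using dnet_exhaust .
  obtain \<sigma> where \<sigma>: "net_iso \<sigma> G H" "\<sigma> p = q" "\<sigma> p' = q'"
    using abs_dnet_eqD[OF H(2) assms H(3-5)] .
  show "swap_roots (abs_dnet (G, p, p')) = abs_dnet (G, p', p)"
    using abs_dnet_eqI[OF assms(1) H(3) assms(3,2) \<sigma>(1)] \<sigma> by (simp add: swap_roots_def H(1))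
  show "root_fst (abs_dnet (G, p, p')) = abs_rnet (G, p)"
    using abs_rnet_eqI[OF assms(1) H(3) assms(2) \<sigma>(1)] \<sigma> by (simp add: root_fst_def H(1))
qed

section \<open>Continuity of exchanging and of forgetting roots\<close>

lemma continuous_on_generate_topologyI:
  fixes f :: "'a::topological_space \<Rightarrow> 'b::topological_space"
  assumes "(open :: 'b set \<Rightarrow> bool) = generate_topology B" "\<And>S. S \<in> B \<Longrightarrow> open (f -` S)"
  shows "continuous_on UNIV f"
proof -
  have "open (f -` S)" if "generate_topology B S" for S
    using that by induction (auto simp: vimage_Union assms(2) intro: open_Int open_UN)
  then show ?thesis using assms(1) by (simp add: continuous_on_open_vimage)
qed

text \<open>The ball in \<open>dcyl\<close> is taken around the unordered set of roots, so the
  preimage of a cylinder is the cylinder with its two roots exchanged.\<close>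

lemma measurable_swap_roots [measurable]: "swap_roots \<in> borel_measurable borel"
proof (intro borel_measurable_continuous_onI continuous_on_generate_topologyI[OF open_dnet_def])
  fix S assume "S \<in> {dcyl r G p p' |r G p p'. network G \<and> p \<in> verts G \<and> p' \<in> verts G}"
  then obtain r G p p' where S: "S = dcyl r G p p'" "network G" "p \<in> verts G" "p' \<in> verts G"
    by blast
  have "swap_roots -` S = dcyl r G p' p"
  proof (intro set_eqI)
    fix x
    obtain H q q' where H: "x = abs_dnet (H, q, q')" "network H" "q \<in> verts H" "q' \<in> verts H"
      using dnet_exhaust[of x] by metis
    then show "x \<in> swap_roots -` S \<longleftrightarrow> x \<in> dcyl r G p' p"
      by (auto simp: S(1) swap_roots_abs abs_in_dcyl_iff insert_commute)
  qed
  then show "open (swap_roots -` S)" using S open_dcyl by simp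
qed

text \<open>The preimage contains, around each of its points, the doubly rooted cylinder of the same
  radius: an isomorphism of balls around both roots restricts to the ball around the first.\<close>

lemma measurable_root_fst [measurable]: "root_fst \<in> borel_measurable borel"
proof (intro borel_measurable_continuous_onI continuous_on_generate_topologyI[OF open_rnet_def])
  fix S assume "S \<in> {rcyl r G p |r G p. network G \<and> p \<in> verts G}"
  then obtain r G p where S: "S = rcyl r G p" "network G" "p \<in> verts G"
    by blast
  show "open (root_fst -` S)"
  proof (rule openI_dcyl)
    fix H q q' assume H: "network H" "q \<in> verts H" "q' \<in> verts H"
      "abs_dnet (H, q, q') \<in> root_fst -` S"
    then have "abs_rnet (H, q) \<in> S" by (simp add: root_fst_abs)
    then obtain \<sigma> where \<sigma>: "ball_iso r \<sigma> G {p} H" "\<sigma> p = q"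
      using H by (auto simp: S(1) abs_in_rcyl_iff)
    have "dcyl r H q q' \<subseteq> root_fst -` S"
    proof
      fix x assume x: "x \<in> dcyl r H q q'"
      obtain K k k' where K: "x = abs_dnet (K, k, k')" "network K" "k \<in> verts K" "k' \<in> verts K"
        using dnet_exhaust[of x] by metis
      obtain \<tau> where \<tau>: "ball_iso r \<tau> H {q, q'} K" "\<tau> q = k" "\<tau> q' = k'"
        using x K by (auto simp: abs_in_dcyl_iff)
      have "ball_iso r \<tau> H (\<sigma> ` {p}) K"
        using H \<sigma> nball_0[of "{q, q'}" H]
        by (intro ball_iso_restrict(1)[OF H(1) K(2) \<tau>(1), where t = 0]) auto
      then have "abs_rnet (K, k) \<in> S"
        using ball_iso_trans[OF \<sigma>(1)] \<sigma>(2) \<tau>(2) K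
        by (auto simp: S(1) abs_in_rcyl_iff intro!: exI[of _ "\<tau> \<circ> \<sigma>"])
      then show "x \<in> root_fst -` S" using K by (simp add: root_fst_abs)
    qed
    then show "\<exists>r. dcyl r H q q' \<subseteq> root_fst -` S" by blast
  qed
qed


section \<open>Mass transport along a vertex-shift\<close>

lemma mass_out_eq_root_sum: "mass_out g = root_sum (\<lambda>d. ennreal (g d))"
  by (simp add: fun_eq_iff mass_out_def root_sum_def)

lemma mass_in_eq_root_sum: "mass_in g = root_sum (\<lambda>d. ennreal (g (swap_roots d)))"
proof
  fix x
  obtain G p where G: "x = abs_rnet (G, p)" "network G" "p \<in> verts G"
    using rnet_exhaust[of x] by metis
  show "mass_in g x = root_sum (\<lambda>d. ennreal (g (swap_roots d))) x"
    unfolding G(1) mass_in_abs[OF G(2,3)] root_sum_abs[OF G(2,3)]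
    by (intro nn_integral_cong) (simp add: swap_roots_abs G)
qed

lemma root_sum_monotone_convergence_SUP:
  assumes "incseq U"
  shows "root_sum (\<lambda>d. SUP i. U i d) x = (SUP i. root_sum (U i) x)"
proof -
  obtain G p where G: "rep_rnet x = (G, p)" by (cases "rep_rnet x")
  show ?thesis
    unfolding root_sum_def G prod.case
    by (rule nn_integral_monotone_convergence_SUP)
      (use assms in \<open>auto simp: incseq_def le_fun_def\<close>)
qed

lemma root_sum_mono: "(\<And>d. g d \<le> h d) \<Longrightarrow> root_sum g x \<le> root_sum h x"
  unfolding root_sum_def by (auto intro!: nn_integral_mono split: prod.split)

text \<open>\<open>unimodular\<close> tests only real-valued transports. An
  \<open>ennreal\<close>-valued one is an increasing limit of simple functions with finite values,
  which \<open>enn2real\<close> turns into real transports without loss; monotone convergence passes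
  through the vertex sum and then the expectation.\<close>

lemma mass_transport:
  assumes "unimodular M X" and X [measurable]: "X \<in> borel_measurable M"
    and g: "g \<in> borel_measurable borel"
  shows "(\<integral>\<^sup>+\<omega>. root_sum g (X \<omega>) \<partial>M) = (\<integral>\<^sup>+\<omega>. root_sum (\<lambda>d. g (swap_roots d)) (X \<omega>) \<partial>M)"
proof -
  obtain U where U: "\<And>i. simple_function borel (U i)" "incseq U" "\<And>i d. U i d < top"
    and SUP: "\<And>d. (SUP i. U i d) = g d"
    using borel_measurable_implies_simple_function_sequence'[OF g] by blast
  have U_meas [measurable]: "U i \<in> borel_measurable borel" for i
    using U(1) by (rule borel_measurable_simple_function)
  have U': "incseq (\<lambda>i d. U i (swap_roots d))" using U(2) by (auto simp: incseq_def le_fun_def)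
  have "(\<integral>\<^sup>+\<omega>. root_sum (U i) (X \<omega>) \<partial>M) = (\<integral>\<^sup>+\<omega>. root_sum (\<lambda>d. U i (swap_roots d)) (X \<omega>) \<partial>M)" for i
  proof -
    have "(\<lambda>d. enn2real (U i d)) \<in> borel_measurable borel" by measurable
    then have "(\<integral>\<^sup>+\<omega>. mass_out (\<lambda>d. enn2real (U i d)) (X \<omega>) \<partial>M)
        = (\<integral>\<^sup>+\<omega>. mass_in (\<lambda>d. enn2real (U i d)) (X \<omega>) \<partial>M)"
      using assms(1) by (simp add: unimodular_def)
    then show ?thesis
      using U(3) by (simp add: mass_out_eq_root_sum mass_in_eq_root_sum)
  qed
  \<comment> \<open>Stated for a general sequence because it is applied twice: to \<open>U\<close>
    and to \<open>U\<close> with the roots exchanged.\<close>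
  moreover have "(\<integral>\<^sup>+\<omega>. root_sum (\<lambda>d. SUP i. V i d) (X \<omega>) \<partial>M) = (SUP i. \<integral>\<^sup>+\<omega>. root_sum (V i) (X \<omega>) \<partial>M)"
    if V: "incseq V" and V_meas [measurable]: "\<And>i. V i \<in> borel_measurable borel" for V
    unfolding root_sum_monotone_convergence_SUP[OF V]
  proof (rule nn_integral_monotone_convergence_SUP)
    show "incseq (\<lambda>i \<omega>. root_sum (V i) (X \<omega>))"
      using V by (auto simp: incseq_def le_fun_def intro: root_sum_mono)
    show "(\<lambda>\<omega>. root_sum (V i) (X \<omega>)) \<in> borel_measurable M" for i by measurable
  qed
  from this[OF U(2) U_meas] this[OF U'] have
    "(\<integral>\<^sup>+\<omega>. root_sum g (X \<omega>) \<partial>M) = (SUP i. \<integral>\<^sup>+\<omega>. root_sum (U i) (X \<omega>) \<partial>M)"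
    "(\<integral>\<^sup>+\<omega>. root_sum (\<lambda>d. g (swap_roots d)) (X \<omega>) \<partial>M)
      = (SUP i. \<integral>\<^sup>+\<omega>. root_sum (\<lambda>d. U i (swap_roots d)) (X \<omega>) \<partial>M)"
    by (simp_all add: SUP)
  ultimately show ?thesis by simp
qed

section \<open>One step of the shift\<close>

lemma abs_in_shift_pairs_iff:
  assumes f: "vertex_shift f" and G: "network G" "u \<in> verts G" "v \<in> verts G"
  shows "abs_dnet (G, u, v) \<in> shift_pairs f \<longleftrightarrow> f G u = v"
proof
  assume "abs_dnet (G, u, v) \<in> shift_pairs f"
  then obtain H a b where H: "abs_dnet (H, a, b) = abs_dnet (G, u, v)" "network H"
    "a \<in> verts H" "b \<in> verts H" "f H a = b"
    by (auto simp: shift_pairs_def)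
  obtain \<sigma> where \<sigma>: "net_iso \<sigma> H G" "\<sigma> a = u" "\<sigma> b = v" using abs_dnet_eqD[OF H(1-4) G] .
  \<comment> \<open>Equivariance makes the relation independent of the representative through which
    the pair entered \<open>shift_pairs\<close>.\<close>
  have "f G (\<sigma> a) = \<sigma> (f H a)"
    using f H(2,3) G(1) \<sigma>(1) by (simp add: vertex_shift_def)
  then show "f G u = v" using H(5) \<sigma> by simp
next
  assume "f G u = v"
  then show "abs_dnet (G, u, v) \<in> shift_pairs f"
    unfolding shift_pairs_def using G by (intro CollectI exI[of _ G] exI[of _ u] exI[of _ v]) simp
qed

lemma sets_shift_pairs:
  assumes "vertex_shift f"
  shows "shift_pairs f \<in> sets borel"
proof -
  have "(indicator (shift_pairs f) :: dnet \<Rightarrow> real) \<in> borel_measurable borel"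
    using assms by (simp add: vertex_shift_def)
  then show ?thesis unfolding borel_measurable_indicator_iff by simp
qed

text \<open>The outgoing side of the transport: all mass goes from the root to its image, so the sum
  has a single nonzero candidate term.\<close>

lemma root_sum_shift:
  assumes f: "vertex_shift f"
  shows "root_sum (\<lambda>d. indicator (shift_pairs f) d * \<psi> (root_fst d) * \<phi> (root_fst (swap_roots d))) x
    = \<psi> x * \<phi> (move_root f 1 x)"
proof -
  obtain G p where G: "x = abs_rnet (G, p)" "network G" "p \<in> verts G"
    using rnet_exhaust[of x] by metis
  have fp: "f G p \<in> verts G" using funpow_in_verts[OF f G(2,3), of 1] by simp
  let ?c = "\<psi> (abs_rnet (G, p)) * \<phi> (abs_rnet (G, f G p))"
  have "root_sum (\<lambda>d. indicator (shift_pairs f) d * \<psi> (root_fst d) * \<phi> (root_fst (swap_roots d))) x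
    = (\<integral>\<^sup>+u. ?c * indicator {f G p} u \<partial>count_space (verts G))"
    unfolding G(1) root_sum_abs[OF G(2,3)]
    by (intro nn_integral_cong)
      (auto simp: G indicator_def abs_in_shift_pairs_iff[OF f] root_fst_abs swap_roots_abs)
  also have "\<dots> = ?c" using fp by (simp add: nn_integral_cmult_indicator)
  finally show ?thesis using move_root_abs[OF f G(2,3), of 1] by (simp add: G(1))
qed

text \<open>The indicator of the preimage of \<open>A\<close> is itself a \<open>root_sum\<close>,
  namely the outgoing mass for \<open>\<psi> = 1\<close> and \<phi> the indicator of
  \<open>A\<close>.\<close>

lemma measurable_move_root_1:
  assumes f: "vertex_shift f"
  shows "move_root f 1 \<in> borel_measurable borel"
proof (rule measurableI)
  fix A :: "rnet set" assume A [measurable]: "A \<in> sets borel"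
  note [measurable] = sets_shift_pairs[OF f]
  let ?g = "\<lambda>d. indicator (shift_pairs f) d * 1 * indicator A (root_fst (swap_roots d)) :: ennreal"
  have "root_sum ?g \<in> borel_measurable borel" by measurable
  also have "root_sum ?g = indicator (move_root f 1 -` A)"
    using root_sum_shift[OF f, of "\<lambda>_. 1" "indicator A"] by (auto simp: fun_eq_iff indicator_def)
  finally show "move_root f 1 -` A \<inter> space borel \<in> sets borel"
    unfolding borel_measurable_indicator_iff .
qed simp

text \<open>Peeling off the first step leaves \<open>move_root f n\<close> to be absorbed into the
  test function \<phi> when the one-step identity is applied.\<close>

lemma move_root_Suc:
  assumes f: "vertex_shift f"
  shows "move_root f (Suc n) x = move_root f n (move_root f 1 x)"
proof -
  obtain G p where G: "x = abs_rnet (G, p)" "network G" "p \<in> verts G"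
    using rnet_exhaust[of x] by metis
  have "f G p \<in> verts G" using funpow_in_verts[OF f G(2,3), of 1] by simp
  then show ?thesis
    using move_root_abs[OF f G(2,3), of 1] move_root_abs[OF f G(2,3), of "Suc n"]
      move_root_abs[OF f G(2), of "f G p" n]
    by (simp add: G(1) funpow_Suc_right del: funpow.simps)
qed

lemma move_root_0: "move_root f 0 x = x"
proof -
  obtain G p where "rep_rnet x = (G, p)" "x = abs_rnet (G, p)"
    using rnet_exhaust[of x] by metis
  then show ?thesis by (simp add: move_root_def)
qed

lemma measurable_move_root:
  assumes f: "vertex_shift f"
  shows "move_root f n \<in> borel_measurable borel"
proof (induction n)
  case 0
  show ?case
    by (subst measurable_cong[of _ _ "\<lambda>x. x"]) (simp_all add: move_root_0)
next
  case (Suc n)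
  show ?case
    by (rule measurable_cong[THEN iffD2, OF _ measurable_compose[OF measurable_move_root_1[OF f] Suc]])
      (rule move_root_Suc[OF f])
qed

text \<open>The operator \<open>T\<close> of the opening overview: the transfer operator of the
  shift, dual to composition with \<open>move_root f 1\<close>. The roots are swapped because
  \<open>root_sum\<close> fixes the first root, which here is the target of the shift.\<close>

definition preimage_sum :: "(net \<Rightarrow> nat \<Rightarrow> nat) \<Rightarrow> (rnet \<Rightarrow> ennreal) \<Rightarrow> rnet \<Rightarrow> ennreal" where
  "preimage_sum f \<psi> = root_sum
     (\<lambda>d. indicator (shift_pairs f) (swap_roots d) * \<psi> (root_fst (swap_roots d)))"

lemma measurable_preimage_sum:
  assumes "vertex_shift f" and [measurable]: "\<psi> \<in> borel_measurable borel"
  shows "preimage_sum f \<psi> \<in> borel_measurable borel"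
proof -
  note [measurable] = sets_shift_pairs[OF assms(1)]
  show ?thesis unfolding preimage_sum_def by measurable
qed

lemma measurable_preimage_sum_funpow:
  assumes "vertex_shift f" "\<psi> \<in> borel_measurable borel"
  shows "(preimage_sum f ^^ n) \<psi> \<in> borel_measurable borel"
  using assms by (induction n) (auto intro: measurable_preimage_sum)

lemma preimage_sum_abs:
  assumes f: "vertex_shift f" and G: "network G" "p \<in> verts G"
  shows "preimage_sum f \<psi> (abs_rnet (G, p)) =
    (\<integral>\<^sup>+u. \<psi> (abs_rnet (G, u)) \<partial>count_space {u \<in> verts G. f G u = p})"
proof -
  have "preimage_sum f \<psi> (abs_rnet (G, p)) =
      (\<integral>\<^sup>+u. indicator {u. f G u = p} u * \<psi> (abs_rnet (G, u)) \<partial>count_space (verts G))"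
    unfolding preimage_sum_def root_sum_abs[OF G]
    by (intro nn_integral_cong)
      (auto simp: G indicator_def abs_in_shift_pairs_iff[OF f] root_fst_abs swap_roots_abs)
  also have "\<dots> = (\<integral>\<^sup>+u. \<psi> (abs_rnet (G, u)) \<partial>count_space {u \<in> verts G. f G u = p})"
    by (auto simp: nn_integral_count_space_indicator indicator_def intro!: nn_integral_cong)
  finally show ?thesis .
qed

text \<open>Outgoing mass is one term by \<open>root_sum_shift\<close>. On the incoming side the
  receiver is the root, so the factor \<phi> is constant and leaves the sum, and what remains is
  \<open>preimage_sum\<close>.\<close>

lemma nn_integral_move_root_1:
  assumes f: "vertex_shift f" and uni: "unimodular M X" and X: "X \<in> borel_measurable M"
    and [measurable]: "\<phi> \<in> borel_measurable borel" "\<psi> \<in> borel_measurable borel"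
  shows "(\<integral>\<^sup>+\<omega>. \<psi> (X \<omega>) * \<phi> (move_root f 1 (X \<omega>)) \<partial>M) =
    (\<integral>\<^sup>+\<omega>. preimage_sum f \<psi> (X \<omega>) * \<phi> (X \<omega>) \<partial>M)"
proof -
  note [measurable] = sets_shift_pairs[OF f]
  let ?g = "\<lambda>d. indicator (shift_pairs f) d * \<psi> (root_fst d) * \<phi> (root_fst (swap_roots d))"
  have "?g \<in> borel_measurable borel" by measurable
  note mass_transport[OF uni X this]
  moreover have "root_sum (\<lambda>d. ?g (swap_roots d)) x = preimage_sum f \<psi> x * \<phi> x" for x
  proof -
    obtain G p where G: "x = abs_rnet (G, p)" "network G" "p \<in> verts G"
      using rnet_exhaust[of x] by metis
    have "root_sum (\<lambda>d. ?g (swap_roots d)) x = (\<integral>\<^sup>+u. indicator (shift_pairs f) (swap_roots (abs_dnet (G, p, u)))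
        * \<psi> (root_fst (swap_roots (abs_dnet (G, p, u)))) * \<phi> x \<partial>count_space (verts G))"
      unfolding G(1) root_sum_abs[OF G(2,3)]
      by (intro nn_integral_cong) (simp add: G swap_roots_abs root_fst_abs)
    also have "\<dots> = preimage_sum f \<psi> x * \<phi> x"
      unfolding preimage_sum_def G(1) root_sum_abs[OF G(2,3)] by (simp add: nn_integral_multc)
    finally show ?thesis .
  qed
  ultimately show ?thesis by (simp only: root_sum_shift[OF f])
qed

lemma nn_integral_move_root:
  assumes f: "vertex_shift f" and uni: "unimodular M X" and X: "X \<in> borel_measurable M"
    and \<phi>: "\<phi> \<in> borel_measurable borel" and "\<psi> \<in> borel_measurable borel"
  shows "(\<integral>\<^sup>+\<omega>. \<psi> (X \<omega>) * \<phi> (move_root f n (X \<omega>)) \<partial>M) =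
    (\<integral>\<^sup>+\<omega>. (preimage_sum f ^^ n) \<psi> (X \<omega>) * \<phi> (X \<omega>) \<partial>M)"
  using assms(5)
\<comment> \<open>\<psi> must vary, since each step replaces it by
  \<open>preimage_sum f \<psi>\<close>.\<close>
proof (induction n arbitrary: \<psi>)
  case 0
  then show ?case by (simp add: move_root_0)
next
  case (Suc n)
  have meas: "(\<lambda>x. \<phi> (move_root f n x)) \<in> borel_measurable borel"
    using measurable_compose[OF measurable_move_root[OF f] \<phi>] .
  have "(\<integral>\<^sup>+\<omega>. \<psi> (X \<omega>) * \<phi> (move_root f (Suc n) (X \<omega>)) \<partial>M) =
      (\<integral>\<^sup>+\<omega>. \<psi> (X \<omega>) * \<phi> (move_root f n (move_root f 1 (X \<omega>))) \<partial>M)"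
    by (simp only: move_root_Suc[OF f])
  also have "\<dots> = (\<integral>\<^sup>+\<omega>. preimage_sum f \<psi> (X \<omega>) * \<phi> (move_root f n (X \<omega>)) \<partial>M)"
    by (rule nn_integral_move_root_1[OF f uni X meas Suc.prems])
  also have "\<dots> = (\<integral>\<^sup>+\<omega>. (preimage_sum f ^^ n) (preimage_sum f \<psi>) (X \<omega>) * \<phi> (X \<omega>) \<partial>M)"
    by (rule Suc.IH[OF measurable_preimage_sum[OF f Suc.prems]])
  finally show ?case unfolding funpow_Suc_right comp_apply .
qed

lemma preimage_sum_funpow_one_abs:
  assumes f: "vertex_shift f" and G: "network G" "p \<in> verts G"
  shows "(preimage_sum f ^^ n) (\<lambda>_. 1) (abs_rnet (G, p)) =
    emeasure (count_space UNIV) {v \<in> verts G. (f G ^^ n) v = p}"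
  using G(2)
proof (induction n arbitrary: p)
  case 0
  have eq: "{v \<in> verts G. (f G ^^ 0) v = p} = {p}" using 0 by auto
  show ?case unfolding eq by simp
next
  case (Suc n)
  let ?I = "{v \<in> verts G. f G v = p}"
  let ?P = "\<lambda>v. {u \<in> verts G. (f G ^^ n) u = v}"
  have "(preimage_sum f ^^ Suc n) (\<lambda>_. 1) (abs_rnet (G, p)) =
      (\<integral>\<^sup>+v. (preimage_sum f ^^ n) (\<lambda>_. 1) (abs_rnet (G, v)) \<partial>count_space ?I)"
    unfolding funpow.simps comp_apply by (rule preimage_sum_abs[OF f G(1) Suc.prems])
  also have "\<dots> = (\<integral>\<^sup>+v. emeasure (count_space UNIV) (?P v) \<partial>count_space ?I)"
    by (rule nn_integral_cong) (rule Suc.IH, simp)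
  \<comment> \<open>Countable additivity: the fibres are disjoint because \<open>u\<close>
    determines \<open>v\<close> as its \<open>n\<close>-th image, and the index set consists of
    natural numbers.\<close>
  also have "\<dots> = emeasure (count_space UNIV) (\<Union>v\<in>?I. ?P v)"
    by (rule emeasure_UN_countable[symmetric]) (auto simp: disjoint_family_on_def)
  also have "(\<Union>v\<in>?I. ?P v) = {v \<in> verts G. (f G ^^ Suc n) v = p}"
    by (auto intro: funpow_in_verts[OF f G(1)])
  finally show ?case .
qed

text \<open>\<open>descendants\<close> excludes the root, so an \<open>n\<close>-periodic root
  contributes itself as one further preimage.\<close>

lemma preimage_sum_funpow_one:
  assumes f: "vertex_shift f"
  shows "(preimage_sum f ^^ n) (\<lambda>_. 1) x = desc_count f n x + of_bool (root_returns f n x)"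
proof -
  obtain G p where G: "x = abs_rnet (G, p)" "network G" "p \<in> verts G"
    using rnet_exhaust[of x] by metis
  \<comment> \<open>\<open>?R\<close> is the singleton of the root or empty, according to whether
    the root returns.\<close>
  let ?D = "descendants f n G p" and ?R = "{v. v = p \<and> (f G ^^ n) p = p}"
  have eq: "{v \<in> verts G. (f G ^^ n) v = p} = ?D \<union> ?R"
    using G(3) by (auto simp: descendants_def)
  have "emeasure (count_space UNIV) {v \<in> verts G. (f G ^^ n) v = p} =
      emeasure (count_space UNIV) ?D + emeasure (count_space UNIV) ?R"
    unfolding eq by (rule plus_emeasure[symmetric]) (auto simp: descendants_def)
  moreover have "emeasure (count_space UNIV) ?R = of_bool ((f G ^^ n) p = p)"
    by (cases "(f G ^^ n) p = p") simp_all
  ultimately show ?thesis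
    by (simp add: G(1) preimage_sum_funpow_one_abs[OF f G(2,3)] desc_count_abs[OF f G(2,3)]
        root_returns_abs[OF f G(2,3)])
qed

section \<open>The law of the shifted root and its Radon-Nikodym derivative\<close>

theorem lemma58:
  fixes M :: "'a measure" and X :: "'a \<Rightarrow> rnet"
    and f :: "net \<Rightarrow> nat \<Rightarrow> nat" and n :: nat
  assumes "prob_space M"
    and "X \<in> borel_measurable M"
    and "unimodular M X"
    and "vertex_shift f"
    and "n \<ge> 1"
  shows "let P0 = distr M borel X;
             Pfn = distr M borel (\<lambda>\<omega>. move_root f n (X \<omega>))
         in absolutely_continuous P0 Pfn \<and>
            (AE x in P0. RN_deriv P0 Pfn x = desc_count f n x + of_bool (root_returns f n x))"
proof -
  let ?d = "(preimage_sum f ^^ n) (\<lambda>_. 1)"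
  define P0 where "P0 = distr M borel X"
  define Pfn where "Pfn = distr M borel (\<lambda>\<omega>. move_root f n (X \<omega>))"
  note X [measurable] = assms(2) and [measurable] = measurable_move_root[OF assms(4)]
  have d [measurable]: "?d \<in> borel_measurable borel"
    by (rule measurable_preimage_sum_funpow[OF assms(4)]) simp
  \<comment> \<open>This makes \<open>P0\<close> sigma-finite, as the uniqueness of the
    Radon-Nikodym derivative at the end requires.\<close>
  interpret prob_space P0
    unfolding P0_def by (rule prob_space.prob_space_distr[OF assms(1) X])
  \<comment> \<open>The \<open>n\<close>-step identity with \<open>\<psi> = 1\<close> and \<phi> the
    indicator of \<open>A\<close>; the factor 1 is written out below to match \<psi>.\<close>
  have density: "density P0 ?d = Pfn"
  proof (rule measure_eqI)
    fix A assume "A \<in> sets (density P0 ?d)"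
    then have A [measurable]: "A \<in> sets borel" by (simp add: P0_def)
    have "emeasure (density P0 ?d) A = (\<integral>\<^sup>+\<omega>. ?d (X \<omega>) * indicator A (X \<omega>) \<partial>M)"
      by (simp add: emeasure_density P0_def nn_integral_distr)
    also have "\<dots> = (\<integral>\<^sup>+\<omega>. 1 * indicator A (move_root f n (X \<omega>)) \<partial>M)"
      by (rule nn_integral_move_root[OF assms(4,3) X, symmetric]) simp_all
    also have "\<dots> = (\<integral>\<^sup>+\<omega>. indicator A (move_root f n (X \<omega>)) \<partial>M)"
      by simp
    also have "\<dots> = (\<integral>\<^sup>+x. indicator A x \<partial>Pfn)"
      unfolding Pfn_def by (rule nn_integral_distr[symmetric]) measurable
    also have "\<dots> = emeasure Pfn A" by (simp add: Pfn_def)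
    finally show "emeasure (density P0 ?d) A = emeasure Pfn A" .
  qed (simp add: P0_def Pfn_def)
  have d' : "?d \<in> borel_measurable P0" by (simp add: P0_def)
  have "absolutely_continuous P0 Pfn"
    using absolutely_continuousI_density[OF d'] by (simp add: density)
  moreover have "AE x in P0. RN_deriv P0 Pfn x = desc_count f n x + of_bool (root_returns f n x)"
    using RN_deriv_unique[OF d' density]
    by (rule eventually_mono) (simp only: preimage_sum_funpow_one[OF assms(4)])
  ultimately show ?thesis
    unfolding Let_def P0_def[symmetric] Pfn_def[symmetric] by (rule conjI)
qed

end
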